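(* Let $G$ be a finite planar graph with no two intersecting triangles and such that every triangle of $G$ is adjacent to at most one $4$-cycle. Then $G$ is adaptably $3$-choosable (i.e. $\mathrm{ch}_{ad}(G)\le 3$), and hence $G$ is $(3,1)$-choosable.
   Context: A triangle is a $3$-cycle. Two cycles are adjacent if they share a common edge, and intersecting if they have at least one common vertex. Given a (possibly improper) edge coloring $F$ of $G$ with integers, a vertex coloring $c$ is adapted to $F$ if no edge $uv$ satisfies $c(u)=c(v)=F(uv)$. $G$ is adaptably $k$-choosable if for every edge coloring $F$ and every list assignment $L$ with $|L(v)|\ge k$ for all $v$, there is a coloring $c$ adapted to $F$ with $c(v)\in L(v)$ for all $v$; $\mathrm{ch}_{ad}(G)$ is the least such $k$. A $(k,d)$-list assignment assigns to each vertex a list of at least $k$ colors such that adjacent vertices' lists share at most $d$ colors; $G$ is $(k,d)$-choosable if for every such assignment $L$ there is a proper vertex coloring from the lists. *)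

theory Defs
  imports "HOL-Analysis.Analysis"
begin

definition simple_graph :: "'a set \<Rightarrow> 'a set set \<Rightarrow> bool" where
  "simple_graph V E \<longleftrightarrow> finite V \<and>
     (\<forall>e\<in>E. \<exists>u v. e = {u, v} \<and> u \<noteq> v \<and> u \<in> V \<and> v \<in> V)"

definition planar_graph :: "'a set \<Rightarrow> 'a set set \<Rightarrow> bool" where
  "planar_graph V E \<longleftrightarrow>
     (\<exists>(p :: 'a \<Rightarrow> complex) (\<gamma> :: 'a set \<Rightarrow> real \<Rightarrow> complex).
        inj_on p V \<and>
        (\<forall>e\<in>E. arc (\<gamma> e) \<and> {pathstart (\<gamma> e), pathfinish (\<gamma> e)} = p ` e \<and>
                path_image (\<gamma> e) \<inter> p ` V = p ` e) \<and>
        (\<forall>e1\<in>E. \<forall>e2\<in>E. e1 \<noteq> e2 \<longrightarrow>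
                path_image (\<gamma> e1) \<inter> path_image (\<gamma> e2) \<subseteq> p ` (e1 \<inter> e2)))"

definition cycle_edges :: "'a list \<Rightarrow> 'a set set" where
  "cycle_edges vs = {{vs ! i, vs ! ((i + 1) mod length vs)} | i. i < length vs}"

definition is_cycle :: "'a set \<Rightarrow> 'a set set \<Rightarrow> nat \<Rightarrow> 'a set set \<Rightarrow> bool" where
  "is_cycle V E k C \<longleftrightarrow>
     (\<exists>vs. length vs = k \<and> 3 \<le> k \<and> distinct vs \<and> set vs \<subseteq> V \<and>
           C = cycle_edges vs \<and> C \<subseteq> E)"

abbreviation triangle :: "'a set \<Rightarrow> 'a set set \<Rightarrow> 'a set set \<Rightarrow> bool" where
  "triangle V E C \<equiv> is_cycle V E 3 C"

definition cycle_vertices :: "'a set set \<Rightarrow> 'a set" where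
  "cycle_vertices C = \<Union>C"

definition adjacent_cycles :: "'a set set \<Rightarrow> 'a set set \<Rightarrow> bool" where
  "adjacent_cycles C D \<longleftrightarrow> C \<inter> D \<noteq> {}"

definition intersecting_cycles :: "'a set set \<Rightarrow> 'a set set \<Rightarrow> bool" where
  "intersecting_cycles C D \<longleftrightarrow> cycle_vertices C \<inter> cycle_vertices D \<noteq> {}"

definition adapted :: "'a set set \<Rightarrow> ('a set \<Rightarrow> int) \<Rightarrow> ('a \<Rightarrow> int) \<Rightarrow> bool" where
  "adapted E F c \<longleftrightarrow> (\<forall>u v. {u, v} \<in> E \<longrightarrow> \<not> (c u = F {u, v} \<and> c v = F {u, v}))"

definition adaptably_choosable :: "'a set \<Rightarrow> 'a set set \<Rightarrow> nat \<Rightarrow> bool" where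
  "adaptably_choosable V E k \<longleftrightarrow>
     (\<forall>(F :: 'a set \<Rightarrow> int) (L :: 'a \<Rightarrow> int set).
        (\<forall>v\<in>V. finite (L v) \<and> k \<le> card (L v)) \<longrightarrow>
        (\<exists>c. adapted E F c \<and> (\<forall>v\<in>V. c v \<in> L v)))"

definition kd_list_assignment :: "'a set \<Rightarrow> 'a set set \<Rightarrow> nat \<Rightarrow> nat \<Rightarrow> ('a \<Rightarrow> int set) \<Rightarrow> bool" where
  "kd_list_assignment V E k d L \<longleftrightarrow>
     (\<forall>v\<in>V. finite (L v) \<and> k \<le> card (L v)) \<and>
     (\<forall>u v. {u, v} \<in> E \<longrightarrow> card (L u \<inter> L v) \<le> d)"

definition proper_colouring :: "'a set set \<Rightarrow> ('a \<Rightarrow> int) \<Rightarrow> bool" where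
  "proper_colouring E c \<longleftrightarrow> (\<forall>u v. {u, v} \<in> E \<longrightarrow> u \<noteq> v \<longrightarrow> c u \<noteq> c v)"

definition kd_choosable :: "'a set \<Rightarrow> 'a set set \<Rightarrow> nat \<Rightarrow> nat \<Rightarrow> bool" where
  "kd_choosable V E k d \<longleftrightarrow>
     (\<forall>L. kd_list_assignment V E k d L \<longrightarrow>
        (\<exists>c. proper_colouring E c \<and> (\<forall>v\<in>V. c v \<in> L v)))"

end

theory Submission
  imports Defs
begin

text \<open>
  If every edge can be assigned to one of its endpoints so that no vertex receives more than two edges,
  then colouring each vertex by a list colour different from the (at most two) colours of its
  own edges is adapted. By Hakimi's criterion such an assignment exists once every vertex set
  \<open>X\<close> spans at most \<open>2 * card X\<close> edges, and as the hypotheses are hereditary it suffices to bound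
  \<open>card E\<close>. A minimal counterexample is 2-connected with minimum degree 3, and Euler's formula
  reduces the bound to the claim that the face lengths average at least 4. Each triangular face has
  at least two edges whose other side is a face of length at least 5, and takes charge 1/2
  across each of these. As triangles are disjoint and no vertex has degree 2, the edges across
  which a face of length \<open>d \<ge> 5\<close> pays form a matching on its boundary, so it pays at most
  \<open>\<lfloor>d/2\<rfloor>/2 \<le> d - 4\<close>.

  The faces are obtained from the Jordan curve theorem: given a cycle \<open>C\<close> with something
  drawn inside, 2-connectedness yields a path inside \<open>C\<close> joining two of its vertices, the theta-curve
  theorem splits the inside in two, and one recurses. An inversion centred inside \<open>C\<close> exchanges
  the two sides, so the outside of \<open>C\<close> is handled by the same statement.
\<close>

section \<open>Paths and cycles\<close>

fun path_edges :: "'a list \<Rightarrow> 'a set set" where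
  "path_edges (x # y # zs) = insert {x, y} (path_edges (y # zs))"
| "path_edges _ = {}"

lemma path_edges_append: "path_edges (xs @ y # zs) = path_edges (xs @ [y]) \<union> path_edges (y # zs)"
proof (induction xs)
  case (Cons x xs)
  then show ?case by (cases xs) auto
qed simp

lemma path_edges_rev: "path_edges (rev xs) = path_edges xs"
proof (induction xs rule: path_edges.induct)
  case (1 x y zs)
  have "path_edges (rev (x # y # zs)) = path_edges (rev zs @ [y]) \<union> path_edges [y, x]"
    using path_edges_append[of "rev zs" y "[x]"] by simp
  then show ?case using 1 by (auto simp: insert_commute)
qed auto

lemma path_edges_subset: "e \<in> path_edges xs \<Longrightarrow> e \<subseteq> set xs"
  by (induction xs rule: path_edges.induct) auto

lemma Union_path_edges: "xs \<noteq> [] \<Longrightarrow> \<Union>(path_edges (x # xs)) = set (x # xs)"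
proof (induction xs arbitrary: x)
  case (Cons y xs)
  then show ?case by (cases "xs = []") auto
qed simp

lemma finite_path_edges [simp]: "finite (path_edges xs)"
  by (induction xs rule: path_edges.induct) auto

lemma path_edges_no_self: "distinct xs \<Longrightarrow> e \<in> path_edges xs \<Longrightarrow> \<exists>x y. e = {x, y} \<and> x \<noteq> y"
  by (induction xs rule: path_edges.induct) auto

lemma path_edges_Cons: "zs \<noteq> [] \<Longrightarrow> path_edges (y # zs) = insert {y, hd zs} (path_edges zs)"
  by (cases zs) auto

lemma card_path_edges: "distinct (x # xs) \<Longrightarrow> card (path_edges (x # xs)) = length xs"
proof (induction xs arbitrary: x)
  case (Cons y xs)
  have "{x, y} \<notin> path_edges (y # xs)"
    using Cons.prems path_edges_subset[of "{x,y}" "y # xs"] by auto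
  then show ?case using Cons by simp
qed simp

lemma path_edges_ends:
  assumes "distinct (u # xs @ [v])" "{u, v} \<in> path_edges (u # xs @ [v])"
  shows "xs = []"
proof (cases xs)
  case (Cons x xs')
  then have "{u, v} \<in> path_edges (x # xs' @ [v])"
    using assms by (auto simp: doubleton_eq_iff)
  then show ?thesis using path_edges_subset[of "{u,v}" "x # xs' @ [v]"] assms Cons by auto
qed simp

lemma path_edges_incident:
  assumes "distinct (y # zs)" "zs \<noteq> []"
  shows "{e \<in> path_edges (y # zs). y \<in> e} = {{y, hd zs}}"
  using assms path_edges_subset[of _ zs] by (auto simp: path_edges_Cons)

lemma path_edges_nth: "path_edges xs = {{xs ! i, xs ! Suc i} | i. Suc i < length xs}"
proof (induction xs rule: path_edges.induct)
  case (1 x y zs)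
  have "{{(x # y # zs) ! i, (x # y # zs) ! Suc i} | i. Suc i < length (x # y # zs)}
      = insert {x, y} {{(y # zs) ! i, (y # zs) ! Suc i} | i. Suc i < length (y # zs)}" (is "?L = ?R")
  proof
    show "?L \<subseteq> ?R"
    proof
      fix e assume "e \<in> ?L"
      then obtain i where i: "Suc i < length (x # y # zs)"
        and e: "e = {(x # y # zs) ! i, (x # y # zs) ! Suc i}" by blast
      then show "e \<in> ?R" by (cases i) auto
    qed
    show "?R \<subseteq> ?L"
    proof
      fix e assume "e \<in> ?R"
      then consider "e = {x, y}"
        | i where "Suc i < length (y # zs)" "e = {(y # zs) ! i, (y # zs) ! Suc i}" by blast
      then show "e \<in> ?L"
      proof cases
        case 1 then show ?thesis by (intro CollectI exI[of _ 0]) auto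
      next
        case 2 then show ?thesis by (intro CollectI exI[of _ "Suc i"]) auto
      qed
    qed
  qed
  then show ?case using 1 by simp
qed auto

lemma path_edges_disjoint:
  assumes "distinct (u # v # xs @ ys)" "xs \<noteq> [] \<or> ys \<noteq> []"
  shows "path_edges (u # xs @ [v]) \<inter> path_edges (u # ys @ [v]) = {}"
proof (rule ccontr)
  assume "\<not> ?thesis"
  then obtain e where e: "e \<in> path_edges (u # xs @ [v])" "e \<in> path_edges (u # ys @ [v])" by blast
  \<comment> \<open>The paths share only their ends, so a common edge can only be
    \<open>{u, v}\<close>. By \<open>path_edges_ends\<close> both paths would then be a single edge,
    which the second hypothesis excludes.\<close>
  then have "e \<subseteq> {u, v}" using path_edges_subset[OF e(1)] path_edges_subset[OF e(2)] assms(1) by auto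
  moreover obtain x y where "e = {x, y}" "x \<noteq> y"
    using path_edges_no_self[OF _ e(1)] assms(1) by auto
  ultimately have "e = {u, v}" by auto
  then show False using path_edges_ends[of u xs v] path_edges_ends[of u ys v] e assms by auto
qed

section \<open>Cycles as edge sets\<close>

text \<open>The closed list repeats its first vertex so that the lemmas on \<open>path_edges\<close>
  apply to cycles; \<open>2 \<le> length zs\<close> excludes doubled edges. The length is not a
  parameter: \<open>is_cyc_is_cycle\<close> recovers it as \<open>card D\<close>.\<close>

definition is_cyc :: "'a set set \<Rightarrow> 'a set set \<Rightarrow> bool" where
  "is_cyc E D \<longleftrightarrow> (\<exists>a zs. distinct (a # zs) \<and> 2 \<le> length zs \<and> D = path_edges (a # zs @ [a]) \<and> D \<subseteq> E)"

text \<open>With its converse \<open>is_cyc_twoE\<close>, this turns cycles into pairs of internally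
  disjoint paths with common ends, the form needed for theta curves. The closed list runs out along
  \<open>xs\<close> and returns along \<open>rev ys\<close>.\<close>

lemma is_cyc_twoI:
  assumes "distinct (u # v # xs @ ys)" "xs \<noteq> [] \<or> ys \<noteq> []"
    and "path_edges (u # xs @ [v]) \<union> path_edges (u # ys @ [v]) \<subseteq> E"
  shows "is_cyc E (path_edges (u # xs @ [v]) \<union> path_edges (u # ys @ [v]))"
proof -
  have "path_edges (u # (xs @ v # rev ys) @ [u]) = path_edges (u # xs @ [v]) \<union> path_edges (v # rev ys @ [u])"
    using path_edges_append[of "u # xs" v "rev ys @ [u]"] by simp
  also have "path_edges (v # rev ys @ [u]) = path_edges (u # ys @ [v])"
    using path_edges_rev[of "u # ys @ [v]"] by simp
  finally have eq: "path_edges (u # (xs @ v # rev ys) @ [u])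
    = path_edges (u # xs @ [v]) \<union> path_edges (u # ys @ [v])" .
  show ?thesis unfolding is_cyc_def
    apply (rule exI[of _ u], rule exI[of _ "xs @ v # rev ys"])
    using assms eq by (cases xs; cases ys) auto
qed

lemma is_cyc_rotate:
  assumes "is_cyc E D" "y \<in> \<Union>D"
  obtains zs where "distinct (y # zs)" "2 \<le> length zs" "D = path_edges (y # zs @ [y])" "D \<subseteq> E"
proof -
  obtain a zs where D: "distinct (a # zs)" "2 \<le> length zs" "D = path_edges (a # zs @ [a])" "D \<subseteq> E"
    using assms unfolding is_cyc_def by auto
  have "y \<in> set (a # zs)" using Union_path_edges[of "zs @ [a]" a] assms(2) D by auto
  show thesis
  proof (cases "y = a")
    case True then show ?thesis using that D by blast
  next
    case False
    then obtain l r where zs: "zs = l @ y # r" using \<open>y \<in> set (a # zs)\<close> by (auto dest: split_list)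
    have "D = path_edges (a # l @ [y]) \<union> path_edges (y # r @ [a])"
      using path_edges_append[of "a # l" y "r @ [a]"] D zs by simp
    also have "\<dots> = path_edges (y # (r @ a # l) @ [y])"
      using path_edges_append[of "y # r" a "l @ [y]"] by auto
    finally show ?thesis using that[of "r @ a # l"] D zs by auto
  qed
qed

lemma is_cyc_twoE:
  assumes "is_cyc E D" "u \<in> \<Union>D" "v \<in> \<Union>D" "u \<noteq> v"
  obtains xs ys where "distinct (u # v # xs @ ys)" "xs \<noteq> [] \<or> ys \<noteq> []"
    "D = path_edges (u # xs @ [v]) \<union> path_edges (u # ys @ [v])"
proof -
  obtain zs where D: "distinct (u # zs)" "2 \<le> length zs" "D = path_edges (u # zs @ [u])"
    using is_cyc_rotate[OF assms(1,2)] by metis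
  have "v \<in> set zs" using Union_path_edges[of "zs @ [u]" u] assms D by auto
  then obtain l r where zs: "zs = l @ v # r" by (auto dest: split_list)
  have "D = path_edges (u # l @ [v]) \<union> path_edges (v # r @ [u])"
    using path_edges_append[of "u # l" v "r @ [u]"] D zs by simp
  also have "path_edges (v # r @ [u]) = path_edges (u # rev r @ [v])"
    using path_edges_rev[of "v # r @ [u]"] by simp
  finally show ?thesis using that[of l "rev r"] D zs by (cases "l = []"; cases "r = []") auto
qed

lemma is_cyc_incident:
  assumes "is_cyc E D" "y \<in> \<Union>D"
  obtains e1 e2 where "e1 \<noteq> e2" "{e \<in> D. y \<in> e} = {e1, e2}"
proof -
  obtain zs where D: "distinct (y # zs)" "2 \<le> length zs" "D = path_edges (y # zs @ [y])"
    using is_cyc_rotate[OF assms] by metis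
  \<comment> \<open>Any second vertex \<open>v\<close> serves: it cuts the cycle into two paths from
    \<open>y\<close>, and each contributes exactly its first edge at \<open>y\<close>.\<close>
  have "last zs \<in> \<Union>D" "last zs \<noteq> y"
    using Union_path_edges[of "zs @ [y]" y] D by (cases zs; auto)+
  then obtain v where v: "v \<in> \<Union>D" "v \<noteq> y" by blast
  obtain xs ys where two: "distinct (y # v # xs @ ys)" "xs \<noteq> [] \<or> ys \<noteq> []"
    "D = path_edges (y # xs @ [v]) \<union> path_edges (y # ys @ [v])"
    using is_cyc_twoE[OF assms v(1)] v(2) by metis
  have "{e \<in> D. y \<in> e} = {e \<in> path_edges (y # xs @ [v]). y \<in> e} \<union> {e \<in> path_edges (y # ys @ [v]). y \<in> e}"
    unfolding two(3) by blast
  also have "\<dots> = {{y, hd (xs @ [v])}} \<union> {{y, hd (ys @ [v])}}"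
    using path_edges_incident[of y "xs @ [v]"] path_edges_incident[of y "ys @ [v]"] two(1) by simp
  finally have eq: "{e \<in> D. y \<in> e} = {{y, hd (xs @ [v])}, {y, hd (ys @ [v])}}" by (simp add: insert_commute)
  have "hd (xs @ [v]) \<noteq> hd (ys @ [v])" using two by (cases xs; cases ys) auto
  then have "{y, hd (xs @ [v])} \<noteq> {y, hd (ys @ [v])}" by (auto simp: doubleton_eq_iff)
  then show ?thesis using eq by (rule that)
qed

lemma is_cyc_card:
  assumes "is_cyc E D"
  shows "finite D" "finite (\<Union>D)" "card (\<Union>D) = card D" "3 \<le> card D" "D \<noteq> {}" "D \<subseteq> E"
proof -
  obtain a zs where D: "distinct (a # zs)" "2 \<le> length zs" "D = path_edges (a # zs @ [a])" "D \<subseteq> E"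
    using assms unfolding is_cyc_def by auto
  have U: "\<Union>D = set (a # zs)" using Union_path_edges[of "zs @ [a]" a] D by auto
  have last: "zs = butlast zs @ [last zs]" "butlast zs \<noteq> []" using D(2) by (cases zs rule: rev_cases; auto)+
  \<comment> \<open>The closing edge \<open>{a, last zs}\<close> is split off. It is new by
    \<open>path_edges_ends\<close>, so a cycle has one edge more than the path
    \<open>a # zs\<close>, that is as many edges as vertices.\<close>
  have "path_edges ((a # butlast zs) @ last zs # [a])
      = path_edges ((a # butlast zs) @ [last zs]) \<union> path_edges [last zs, a]"
    by (rule path_edges_append)
  then have "D = insert {a, last zs} (path_edges (a # zs))"
    using D(3) last(1) by (metis Un_insert_right append.assoc append_Cons append_Nil insert_commute
        path_edges.simps(1,3) sup_bot.right_neutral)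
  moreover have "{a, last zs} \<notin> path_edges (a # zs)"
    using path_edges_ends[of a "butlast zs" "last zs"] last D(1) by metis
  ultimately have "card D = Suc (length zs)" using card_path_edges[OF D(1)] by simp
  moreover have "card (\<Union>D) = Suc (length zs)" using U D(1) distinct_card by fastforce
  ultimately show "card (\<Union>D) = card D" "3 \<le> card D" using D(2) by auto
  then show "D \<noteq> {}" by auto
  show "finite D" "finite (\<Union>D)" "D \<subseteq> E" using D U by auto
qed

lemma is_cyc_is_cycle:
  assumes "is_cyc E D" "\<Union>E \<subseteq> V"
  shows "is_cycle V E (card D) D"
proof -
  obtain a zs where D: "distinct (a # zs)" "2 \<le> length zs" "D = path_edges (a # zs @ [a])" "D \<subseteq> E"
    using assms unfolding is_cyc_def by auto
  let ?vs = "a # zs"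
  have U: "\<Union>D = set ?vs" using Union_path_edges[of "zs @ [a]" a] D by auto
  have nth: "(a # zs @ [a]) ! i = ?vs ! i" if "i < length ?vs" for i
    using that nth_append[of ?vs "[a]" i] by simp
  have nth': "(a # zs @ [a]) ! Suc i = ?vs ! ((i + 1) mod length ?vs)" if "i < length ?vs" for i
  proof (cases "Suc i = length ?vs")
    case True
    then show ?thesis using nth_append[of ?vs "[a]" "Suc i"] by simp
  next
    case False
    then have "Suc i < length ?vs" using that by simp
    then show ?thesis using nth[of "Suc i"] by simp
  qed
  have "D = {{(a # zs @ [a]) ! i, (a # zs @ [a]) ! Suc i} | i. i < length ?vs}"
    unfolding D(3) path_edges_nth by auto
  also have "\<dots> = cycle_edges ?vs"
    unfolding cycle_edges_def
  proof (rule Collect_cong, rule ex_cong1, rule rev_conj_cong)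
    fix e i assume "i < length ?vs"
    then show "(e = {(a # zs @ [a]) ! i, (a # zs @ [a]) ! Suc i})
      = (e = {?vs ! i, ?vs ! ((i + 1) mod length ?vs)})"
      by (simp only: nth nth')
  qed simp
  finally have "D = cycle_edges ?vs" .
  moreover have "length ?vs = card D"
    using is_cyc_card(3)[OF assms(1)] U D(1) distinct_card by metis
  moreover have "set ?vs \<subseteq> V" using U D(4) assms(2) by blast
  ultimately show ?thesis using D is_cyc_card(4)[OF assms(1)] unfolding is_cycle_def by metis
qed

section \<open>Plane drawings\<close>

lemma simple_graph_edgeE:
  assumes "simple_graph V E" "e \<in> E"
  obtains u v where "e = {u, v}" "u \<noteq> v" "u \<in> V" "v \<in> V"
proof -
  have "\<exists>u v. e = {u, v} \<and> u \<noteq> v \<and> u \<in> V \<and> v \<in> V" using assms by (simp add: simple_graph_def)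
  then show thesis using that by blast
qed

lemma simple_graph_finite:
  assumes "simple_graph V E"
  shows "finite V" "finite E" "\<Union>E \<subseteq> V"
proof -
  show V: "finite V" using assms by (simp add: simple_graph_def)
  show U: "\<Union>E \<subseteq> V" using simple_graph_edgeE[OF assms] by (metis Sup_least empty_subsetI insert_subset)
  then have "E \<subseteq> Pow V" by auto
  then show "finite E" using V by (simp add: finite_subset)
qed

text \<open>The inverse of an arc would embed a nonempty open subset of the plane into the line,
  against invariance of dimension. This later yields points off the drawing inside a cycle.\<close>

lemma empty_interior_arc:
  fixes g :: "real \<Rightarrow> complex"
  assumes "arc g"
  shows "interior (path_image g) = {}"
proof (rule ccontr)
  assume ne: "interior (path_image g) \<noteq> {}"
  have c: "continuous_on {0..1} g" and i: "inj_on g {0..1}"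
    using assms by (auto simp: arc_def path_def)
  obtain h where h: "homeomorphism {0..1} (path_image g) g h"
    using homeomorphism_compact[OF _ c _ i] by (auto simp: path_image_def)
  have "DIM(complex) \<le> DIM(real)"
  proof (rule invariance_of_dimension[of "interior (path_image g)" h])
    show "continuous_on (interior (path_image g)) h"
      using h interior_subset continuous_on_subset unfolding homeomorphism_def by metis
    show "inj_on h (interior (path_image g))"
      using h interior_subset unfolding homeomorphism_def by (metis inj_on_inverseI inj_on_subset)
  qed (use ne in auto)
  then show False by simp
qed

lemma connected_subset_inside:
  assumes "connected S" "S \<inter> K = {}" "S \<inter> inside K \<noteq> {}"
  shows "S \<subseteq> inside K"
proof
  fix y assume "y \<in> S"
  obtain x where x: "x \<in> S" "x \<in> inside K" using assms(3) by blast
  have "connected_component (- K) x y"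
    using assms x \<open>y \<in> S\<close> unfolding connected_component_def by blast
  then show "y \<in> inside K" using inside_same_component x by blast
qed

locale drawing =
  fixes V :: "'a set" and E :: "'a set set" and p :: "'a \<Rightarrow> complex" and \<gamma> :: "'a set \<Rightarrow> real \<Rightarrow> complex"
  assumes simple: "simple_graph V E"
    and inj: "inj_on p V"
    and arc: "e \<in> E \<Longrightarrow> arc (\<gamma> e)"
    and ends: "e \<in> E \<Longrightarrow> {pathstart (\<gamma> e), pathfinish (\<gamma> e)} = p ` e"
    and verts: "e \<in> E \<Longrightarrow> path_image (\<gamma> e) \<inter> p ` V = p ` e"
    and cross: "e1 \<in> E \<Longrightarrow> e2 \<in> E \<Longrightarrow> e1 \<noteq> e2 \<Longrightarrow>
      path_image (\<gamma> e1) \<inter> path_image (\<gamma> e2) \<subseteq> p ` (e1 \<inter> e2)"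
begin

definition img :: "'a set set \<Rightarrow> complex set" where
  "img D = (\<Union>e\<in>D. path_image (\<gamma> e))"

text \<open>An edge lies inside a cycle not containing it iff its midpoint does; as midpoints lie on no other
  edge, the combinatorial form of the theta-curve theorem below needs no connectedness argument.\<close>

definition mid :: "'a set \<Rightarrow> complex" where
  "mid e = \<gamma> e (1/2)"

definition InE :: "'a set set \<Rightarrow> 'a set set" where
  "InE C = {e \<in> E. mid e \<in> inside (img C)}"

definition InV :: "'a set set \<Rightarrow> 'a set" where
  "InV C = {v \<in> V. p v \<in> inside (img C)}"

lemma img_Un: "img (A \<union> B) = img A \<union> img B"
  by (auto simp: img_def)

lemma edge_sub: "e \<in> E \<Longrightarrow> e \<subseteq> V"
  using simple_graph_finite(3)[OF simple] by (simp add: Sup_le_iff)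

lemma img_vertex:
  assumes "D \<subseteq> E" "v \<in> V"
  shows "p v \<in> img D \<longleftrightarrow> v \<in> \<Union>D"
proof
  assume "p v \<in> img D"
  then obtain e where e: "e \<in> D" "p v \<in> path_image (\<gamma> e)" by (auto simp: img_def)
  then have "p v \<in> p ` e" using verts[of e] assms by blast
  then have "v \<in> e" using inj assms e edge_sub by (metis inj_on_image_mem_iff subsetD)
  then show "v \<in> \<Union>D" using e by blast
next
  assume "v \<in> \<Union>D"
  then obtain e where e: "e \<in> D" "v \<in> e" by blast
  then have "p v \<in> path_image (\<gamma> e)" using verts[of e] assms by blast
  then show "p v \<in> img D" using e by (auto simp: img_def)
qed

lemma mid_not_vertex: "e \<in> E \<Longrightarrow> mid e \<notin> p ` e"
proof
  assume e: "e \<in> E" and "mid e \<in> p ` e"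
  then have "\<gamma> e (1/2) = \<gamma> e 0 \<or> \<gamma> e (1/2) = \<gamma> e 1"
    using ends[OF e] by (auto simp: mid_def pathstart_def pathfinish_def)
  moreover have "inj_on (\<gamma> e) {0..1}" using arc[OF e] by (simp add: arc_def)
  ultimately show False
    using inj_onD[of "\<gamma> e" "{0..1}" "1/2" 0] inj_onD[of "\<gamma> e" "{0..1}" "1/2" 1] by auto
qed

lemma mid_in: "mid e \<in> path_image (\<gamma> e)"
  by (auto simp: mid_def path_image_def)

lemma img_mid:
  assumes "D \<subseteq> E" "e \<in> E"
  shows "mid e \<in> img D \<longleftrightarrow> e \<in> D"
proof
  assume "mid e \<in> img D"
  then obtain e' where e': "e' \<in> D" "mid e \<in> path_image (\<gamma> e')" by (auto simp: img_def)
  then have "e' = e"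
    using cross[of e e'] mid_in[of e] mid_not_vertex[of e] assms by blast
  then show "e \<in> D" using e' by simp
qed (use mid_in in \<open>auto simp: img_def\<close>)

lemma img_Int:
  assumes "A \<subseteq> E" "B \<subseteq> E" "A \<inter> B = {}"
  shows "img A \<inter> img B \<subseteq> p ` (\<Union>A \<inter> \<Union>B)"
proof
  fix z assume "z \<in> img A \<inter> img B"
  then obtain e e' where e: "e \<in> A" "e' \<in> B" "z \<in> path_image (\<gamma> e)" "z \<in> path_image (\<gamma> e')"
    by (auto simp: img_def)
  then have "z \<in> p ` (e \<inter> e')" using cross[of e e'] assms by blast
  then show "z \<in> p ` (\<Union>A \<inter> \<Union>B)" using e by blast
qed

lemma edge_arc:
  assumes "{x, y} \<in> E"
  obtains g where "arc g" "pathstart g = p x" "pathfinish g = p y" "path_image g = path_image (\<gamma> {x, y})"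
proof -
  have e: "{pathstart (\<gamma> {x,y}), pathfinish (\<gamma> {x,y})} = {p x, p y}" using ends[OF assms] by simp
  then consider "pathstart (\<gamma> {x,y}) = p x" "pathfinish (\<gamma> {x,y}) = p y"
    | "pathstart (\<gamma> {x,y}) = p y" "pathfinish (\<gamma> {x,y}) = p x" by (auto simp: doubleton_eq_iff)
  then show thesis
  proof cases
    case 1 then show thesis using that arc[OF assms] by blast
  next
    case 2 then show thesis using that[of "reversepath (\<gamma> {x,y})"] arc[OF assms]
      by (simp add: arc_reversepath)
  qed
qed

lemma path_arc:
  assumes "distinct (x # xs)" "xs \<noteq> []" "path_edges (x # xs) \<subseteq> E"
  shows "\<exists>g. arc g \<and> pathstart g = p x \<and> pathfinish g = p (last xs) \<and> path_image g = img (path_edges (x # xs))"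
  using assms
proof (induction xs arbitrary: x)
  case (Cons y ys)
  have xy: "{x, y} \<in> E" using Cons.prems by simp
  obtain g1 where g1: "arc g1" "pathstart g1 = p x" "pathfinish g1 = p y" "path_image g1 = path_image (\<gamma> {x, y})"
    using edge_arc[OF xy] by blast
  show ?case
  proof (cases "ys = []")
    case True
    then show ?thesis using g1 by (auto simp: img_def)
  next
    case False
    then obtain g2 where g2: "arc g2" "pathstart g2 = p y" "pathfinish g2 = p (last ys)"
      "path_image g2 = img (path_edges (y # ys))"
      using Cons.IH[of y] Cons.prems by auto
    have nin: "{x, y} \<notin> path_edges (y # ys)"
      using Cons.prems path_edges_subset[of "{x,y}" "y # ys"] by auto
    have "path_image g1 \<inter> path_image g2 \<subseteq> p ` (\<Union>{{x,y}} \<inter> \<Union>(path_edges (y # ys)))"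
      using img_Int[of "{{x,y}}" "path_edges (y # ys)"] Cons.prems xy nin g1 g2 by (auto simp: img_def)
    also have "\<dots> \<subseteq> {p y}" using Union_path_edges[OF False, of y] Cons.prems by auto
    finally have "arc (g1 +++ g2)" using g1 g2 by (intro arc_join) auto
    moreover have "path_image (g1 +++ g2) = img (path_edges (x # y # ys))"
      using g1 g2 by (auto simp: path_image_join img_def)
    ultimately show ?thesis using g1 g2 False
      by (intro exI[of _ "g1 +++ g2"]) auto
  qed
qed simp

lemma two_paths_Int:
  assumes "distinct (a # b # xs @ ys)" "xs \<noteq> [] \<or> ys \<noteq> []"
    and "path_edges (a # xs @ [b]) \<subseteq> E" "path_edges (a # ys @ [b]) \<subseteq> E"
  shows "img (path_edges (a # xs @ [b])) \<inter> img (path_edges (a # ys @ [b])) = {p a, p b}"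
proof -
  have UA: "\<Union>(path_edges (a # zs @ [b])) = {a, b} \<union> set zs" for zs
    using Union_path_edges[of "zs @ [b]" a] by auto
  have V: "a \<in> V" "b \<in> V" using UA[of xs] assms(3) edge_sub by blast+
  have "img (path_edges (a # xs @ [b])) \<inter> img (path_edges (a # ys @ [b])) \<subseteq> p ` {a, b}"
    using img_Int[OF assms(3,4) path_edges_disjoint[OF assms(1,2)]] UA[of xs] UA[of ys] assms(1) by auto
  moreover have "p a \<in> img (path_edges (a # zs @ [b]))" "p b \<in> img (path_edges (a # zs @ [b]))"
    if "path_edges (a # zs @ [b]) \<subseteq> E" for zs
    using img_vertex[OF that] V UA[of zs] by auto
  ultimately show ?thesis using assms(3,4) by blast
qed

lemma cyc_curve:
  assumes "is_cyc E C"
  obtains c where "simple_path c" "pathfinish c = pathstart c" "path_image c = img C"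
proof -
  obtain a zs where D: "distinct (a # zs)" "2 \<le> length zs" "C = path_edges (a # zs @ [a])" "C \<subseteq> E"
    using assms unfolding is_cyc_def by auto
  have U: "\<Union>C = set (a # zs)" using Union_path_edges[of "zs @ [a]" a] D by auto
  have "hd zs \<in> \<Union>C" "hd zs \<noteq> a" using D U by (cases zs; auto)+
  then obtain b where b: "b \<in> \<Union>C" "b \<noteq> a" by blast
  obtain xs ys where two: "distinct (a # b # xs @ ys)" "xs \<noteq> [] \<or> ys \<noteq> []"
    "C = path_edges (a # xs @ [b]) \<union> path_edges (a # ys @ [b])"
    using is_cyc_twoE[OF assms, of a b] b U by auto
  have d: "distinct (a # xs @ [b])" "distinct (a # ys @ [b])" using two(1) by auto
  have s: "path_edges (a # xs @ [b]) \<subseteq> E" "path_edges (a # ys @ [b]) \<subseteq> E" using two(3) D(4) by blast+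
  obtain g1 where g1: "arc g1" "pathstart g1 = p a" "pathfinish g1 = p b"
      "path_image g1 = img (path_edges (a # xs @ [b]))"
    using path_arc[OF d(1) _ s(1)] by auto
  obtain g2 where g2: "arc g2" "pathstart g2 = p a" "pathfinish g2 = p b"
      "path_image g2 = img (path_edges (a # ys @ [b]))"
    using path_arc[OF d(2) _ s(2)] by auto
  have I: "path_image g1 \<inter> path_image g2 = {p a, p b}"
    using two_paths_Int[OF two(1,2) s] g1 g2 by simp
  have "simple_path (g1 +++ reversepath g2)"
    using g1 g2 I by (intro simple_path_join_loop) (auto simp: arc_reversepath)
  moreover have "path_image (g1 +++ reversepath g2) = img C"
    using g1 g2 two(3) by (simp add: path_image_join img_Un)
  ultimately show thesis using that g1 g2 by simp
qed

section \<open>Theta curves and the sides of a cycle\<close>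

text \<open>Translates the theta-curve theorem \<open>split_inside_simple_closed_curve\<close> into
  sets of edges and vertices. The conditions \<open>ne\<close> allow at most one of the three paths
  to be a single edge, which keeps them edge-disjoint; \<open>ins\<close> provides a point of the
  third path inside the cycle, and one point is enough.\<close>

lemma theta_split:
  fixes a b xs ys zs
  defines "A \<equiv> path_edges (a # xs @ [b])" and "B \<equiv> path_edges (a # ys @ [b])"
    and "P \<equiv> path_edges (a # zs @ [b])"
  assumes dist: "distinct (a # b # xs @ ys @ zs)"
    and ne: "xs \<noteq> [] \<or> ys \<noteq> []" "xs \<noteq> [] \<or> zs \<noteq> []" "ys \<noteq> [] \<or> zs \<noteq> []"
    and sub: "A \<subseteq> E" "B \<subseteq> E" "P \<subseteq> E"
    and ins: "P \<inter> InE (A \<union> B) \<noteq> {} \<or> set zs \<inter> InV (A \<union> B) \<noteq> {}"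
  shows "InE (A \<union> B) = InE (A \<union> P) \<union> InE (B \<union> P) \<union> P"
    and "InV (A \<union> B) = InV (A \<union> P) \<union> InV (B \<union> P) \<union> set zs"
    and "InE (A \<union> P) \<inter> InE (B \<union> P) = {}" "InV (A \<union> P) \<inter> InV (B \<union> P) = {}"
proof -
  have d: "distinct (a # xs @ [b])" "distinct (a # ys @ [b])" "distinct (a # zs @ [b])"
    "distinct (a # b # xs @ ys)" "distinct (a # b # xs @ zs)" "distinct (a # b # ys @ zs)"
    using dist by auto
  obtain g1 where g1: "arc g1" "pathstart g1 = p a" "pathfinish g1 = p b" "path_image g1 = img A"
    using path_arc[OF d(1)] sub unfolding A_def by auto
  obtain g2 where g2: "arc g2" "pathstart g2 = p a" "pathfinish g2 = p b" "path_image g2 = img B"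
    using path_arc[OF d(2)] sub unfolding B_def by auto
  obtain g where g: "arc g" "pathstart g = p a" "pathfinish g = p b" "path_image g = img P"
    using path_arc[OF d(3)] sub unfolding P_def by auto
  have I: "img A \<inter> img B = {p a, p b}" "img A \<inter> img P = {p a, p b}" "img B \<inter> img P = {p a, p b}"
    using two_paths_Int[OF d(4) ne(1)] two_paths_Int[OF d(5) ne(2)] two_paths_Int[OF d(6) ne(3)] sub
    unfolding A_def B_def P_def by blast+
  have UP: "\<Union>P = {a, b} \<union> set zs" using Union_path_edges[of "zs @ [b]" a] unfolding P_def by auto
  have V: "\<Union>P \<subseteq> V" using sub edge_sub by blast
  have ab: "p a \<noteq> p b" using inj V UP d(3) by (auto dest: inj_onD)
  have meets: "path_image g \<inter> inside (path_image g1 \<union> path_image g2) \<noteq> {}"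
    using ins
  proof
    assume "P \<inter> InE (A \<union> B) \<noteq> {}"
    then obtain e where "e \<in> P" "mid e \<in> inside (img A \<union> img B)" by (auto simp: InE_def img_Un)
    moreover have "mid e \<in> path_image g" using img_mid[of P e] sub(3) g(4) \<open>e \<in> P\<close> by auto
    ultimately show ?thesis unfolding g1(4) g2(4) by blast
  next
    assume "set zs \<inter> InV (A \<union> B) \<noteq> {}"
    then obtain v where "v \<in> set zs" "v \<in> V" "p v \<in> inside (img A \<union> img B)" by (auto simp: InV_def img_Un)
    moreover have "p v \<in> path_image g" using img_vertex[of P v] sub(3) g(4) UP \<open>v \<in> set zs\<close> \<open>v \<in> V\<close> by auto
    ultimately show ?thesis unfolding g1(4) g2(4) by blast
  qed
  have split: "inside (img A \<union> img P) \<inter> inside (img B \<union> img P) = {}"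
    "inside (img A \<union> img P) \<union> inside (img B \<union> img P) \<union> (img P - {p a, p b}) = inside (img A \<union> img B)"
    using split_inside_simple_closed_curve[of g1 "p a" "p b" g2 g] g1 g2 g I ab meets
    by (auto simp: arc_imp_simple_path)
  \<comment> \<open>The theta-curve theorem removes the two branch points from the third arc.
    Midpoints are not vertex images, so no edge of \<open>P\<close> is lost by this.\<close>
  have me: "mid e \<noteq> p a" "mid e \<noteq> p b" if "e \<in> E" for e
  proof -
    have "mid e \<notin> p ` V" using verts[OF that] mid_in[of e] mid_not_vertex[OF that] by blast
    then show "mid e \<noteq> p a" "mid e \<noteq> p b" using UP V by auto
  qed
  show "InE (A \<union> B) = InE (A \<union> P) \<union> InE (B \<union> P) \<union> P"
    unfolding InE_def img_Un split(2)[symmetric] using img_mid[of P] sub me by auto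
  have "p v \<in> img P - {p a, p b} \<longleftrightarrow> v \<in> set zs" if "v \<in> V" for v
  proof -
    have "p v = p a \<longleftrightarrow> v = a" "p v = p b \<longleftrightarrow> v = b" using inj that V UP by (auto dest: inj_onD)
    then show ?thesis using img_vertex[of P v] that sub UP d(3) by auto
  qed
  moreover have "set zs \<subseteq> V" using UP V by blast
  ultimately show "InV (A \<union> B) = InV (A \<union> P) \<union> InV (B \<union> P) \<union> set zs"
    unfolding InV_def img_Un split(2)[symmetric] by blast
  show "InE (A \<union> P) \<inter> InE (B \<union> P) = {}" "InV (A \<union> P) \<inter> InV (B \<union> P) = {}"
    unfolding InE_def InV_def img_Un using split(1) by blast+
qed

lemma InE_disjoint: "C \<subseteq> E \<Longrightarrow> InE C \<inter> C = {}"
proof (rule equals0I)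
  fix e assume "C \<subseteq> E" "e \<in> InE C \<inter> C"
  then have "mid e \<in> inside (img C)" "mid e \<in> img C" using img_mid[of C e] by (auto simp: InE_def)
  then show False using inside_no_overlap[of "img C"] by blast
qed

lemma InV_disjoint: "C \<subseteq> E \<Longrightarrow> InV C \<inter> \<Union>C = {}"
proof (rule equals0I)
  fix v assume "C \<subseteq> E" "v \<in> InV C \<inter> \<Union>C"
  then have "p v \<in> inside (img C)" "p v \<in> img C" using img_vertex[of C v] by (auto simp: InV_def)
  then show False using inside_no_overlap[of "img C"] by blast
qed

text \<open>The edge can meet the cycle only in its other end, so the piece from \<open>p x\<close>
  to the midpoint is connected and avoids the cycle; both ends of this piece lie on the same
  side.\<close>

lemma edge_side:
  assumes C: "C \<subseteq> E" and e: "e \<in> E" "e \<notin> C" and x: "x \<in> e" "x \<notin> \<Union>C"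
  shows "x \<in> InV C \<longleftrightarrow> e \<in> InE C"
proof -
  obtain y where y: "e = {x, y}" "x \<noteq> y"
    using simple_graph_edgeE[OF simple e(1)] x(1) by (metis doubleton_eq_iff insert_iff singletonD)
  then obtain g where g: "arc g" "pathstart g = p x" "pathfinish g = p y" "path_image g = path_image (\<gamma> e)"
    using edge_arc e(1) by metis
  have "mid e \<in> path_image g" using mid_in g by simp
  then obtain t where t: "t \<in> {0..1}" "g t = mid e" by (auto simp: path_image_def)
  have "t \<noteq> 1" using t g(3) mid_not_vertex[OF e(1)] y by (auto simp: pathfinish_def)
  then have t1: "t < 1" using t by auto
  let ?S = "g ` {0..t}"
  have cont: "continuous_on {0..1} g" and ig: "inj_on g {0..1}" using g(1) by (auto simp: arc_def path_def)
  have conn: "connected ?S"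
    by (rule connected_continuous_image[OF continuous_on_subset[OF cont]]) (use t in auto)
  have sub: "?S \<subseteq> path_image (\<gamma> e)" using g(4) t by (auto simp: path_image_def)
  have py: "p y \<notin> ?S"
  proof
    assume "p y \<in> ?S"
    then obtain s where "s \<in> {0..t}" "g s = g 1" using g(3) by (auto simp: pathfinish_def)
    then show False using inj_onD[OF ig, of s 1] t1 by auto
  qed
  have "?S \<inter> img C = {}"
  proof (rule ccontr)
    assume "?S \<inter> img C \<noteq> {}"
    then obtain z where z: "z \<in> ?S" "z \<in> img C" by blast
    then have "z \<in> img {e} \<inter> img C" using sub by (auto simp: img_def)
    then have "z \<in> p ` (e \<inter> \<Union>C)" using img_Int[of "{e}" C] e C by auto
    then have "z = p y" using x y by auto
    then show False using py z by simp
  qed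
  moreover have "p x \<in> ?S" using g(2) t(1) by (intro image_eqI[of _ _ 0]) (auto simp: pathstart_def)
  moreover have "mid e \<in> ?S" using t by force
  ultimately have "p x \<in> inside (img C) \<longleftrightarrow> mid e \<in> inside (img C)"
    using connected_subset_inside[OF conn] by blast
  moreover have "x \<in> V" using x e edge_sub by blast
  ultimately show ?thesis using e by (simp add: InV_def InE_def)
qed

lemma img_closed_empty_interior: "D \<subseteq> E \<Longrightarrow> closed (img D) \<and> interior (img D) = {}"
proof -
  assume D: "D \<subseteq> E"
  have "finite D" using finite_subset[OF D] simple_graph_finite(2)[OF simple] by simp
  then show ?thesis using D
  proof (induction D)
    case (insert e D)
    have "closed (path_image (\<gamma> e))" using arc insert by (simp add: closed_arc_image)
    then have "interior (path_image (\<gamma> e) \<union> img D) = {}"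
      using insert empty_interior_arc[OF arc, of e] by (metis insert_subset interior_closed_Un_empty_interior)
    then show ?case using insert \<open>closed (path_image (\<gamma> e))\<close> by (simp add: img_def closed_Un)
  qed (simp add: img_def)
qed

end

lemma planar_drawing:
  fixes V :: "'a set"
  assumes "simple_graph V E" "planar_graph V E"
  obtains p \<gamma> where "drawing V E p \<gamma>"
proof -
  obtain p :: "'a \<Rightarrow> complex" and \<gamma> where "inj_on p V" and
    1: "\<forall>e\<in>E. arc (\<gamma> e) \<and> {pathstart (\<gamma> e), pathfinish (\<gamma> e)} = p ` e \<and>
                path_image (\<gamma> e) \<inter> p ` V = p ` e" and
    2: "\<forall>e1\<in>E. \<forall>e2\<in>E. e1 \<noteq> e2 \<longrightarrow>
                path_image (\<gamma> e1) \<inter> path_image (\<gamma> e2) \<subseteq> p ` (e1 \<inter> e2)"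
    using assms(2) unfolding planar_graph_def by (elim exE conjE)
  then have "drawing V E p \<gamma>" using assms(1) by unfold_locales auto
  then show thesis by (rule that)
qed

section \<open>Inversion and ears\<close>

text \<open>Near the pole \<open>a\<close> the image of the punctured inside is unbounded; being
  connected, it misses the inside of the image curve. That inside is nonempty, so it contains the
  image of some outside point, and with it the image of the whole connected outside.\<close>

lemma inversion_swaps_sides:
  fixes K :: "complex set" and a :: complex
  defines "f \<equiv> \<lambda>z. inverse (z - a)"
  assumes c: "simple_path c" "pathfinish c = pathstart c" "path_image c = K"
    and c': "simple_path c'" "pathfinish c' = pathstart c'" "path_image c' = f ` K"
    and a: "a \<in> inside K" and z: "z \<noteq> a" "z \<notin> K"
  shows "f z \<in> inside (f ` K) \<longleftrightarrow> z \<notin> inside K"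
proof -
  note J = Jordan_inside_outside[OF c(1,2), unfolded c(3)]
  note J' = Jordan_inside_outside[OF c'(1,2), unfolded c'(3)]
  have io: "inside K \<union> outside K = - K" "inside K \<inter> outside K = {}" using J by metis+
  have aK: "a \<notin> K" using a inside_no_overlap by blast
  have inj: "inj_on f (- {a})" by (auto simp: f_def inj_on_def)
  have cont: "continuous_on S f" if "a \<notin> S" for S
    unfolding f_def using that by (intro continuous_intros) auto
  have disj: "f ` S \<inter> f ` K = {}" if "S \<inter> K = {}" "a \<notin> S" for S
    using that aK inj by (auto simp: f_def)
  define I where "I = inside K - {a}"
  have "connected I" unfolding I_def using J by (intro connected_open_delete) auto
  then have conI: "connected (f ` I)"
    using cont[of I] by (intro connected_continuous_image) (auto simp: I_def)
  have dI: "f ` I \<inter> f ` K = {}" 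
    by (rule disj; use inside_no_overlap[of K] in \<open>unfold I_def, blast\<close>)
  have "\<not> bounded (f ` I)"
  proof
    assume "bounded (f ` I)"
    then obtain B where B: "B > 0" "\<And>w. w \<in> I \<Longrightarrow> norm (f w) \<le> B"
      by (metis bounded_pos imageI)
    obtain r where r: "r > 0" "ball a r \<subseteq> inside K" using J a open_contains_ball by metis
    \<comment> \<open>The term \<open>r/2\<close> keeps the point at distance
      \<open>\<delta>\<close> from \<open>a\<close> in the ball, and \<open>1 / (B + 1)\<close>
      makes the norm of its image, \<open>1 / \<delta>\<close>, exceed \<open>B\<close>.\<close>
    define \<delta> where "\<delta> = min (r/2) (1 / (B + 1))"
    have \<delta>: "\<delta> > 0" "\<delta> < r" "\<delta> \<le> 1 / (B + 1)" using r B unfolding \<delta>_def by auto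
    have "a + of_real \<delta> \<in> I" using r(2) \<delta> unfolding I_def by (auto simp: dist_norm)
    from B(2)[OF this] have "1 / \<delta> \<le> B" using \<delta> by (simp add: f_def norm_inverse divide_inverse)
    then have "1 \<le> B * \<delta>" using \<delta> by (simp add: field_simps)
    also have "\<dots> \<le> B * (1 / (B + 1))" using \<delta> B by (intro mult_left_mono) auto
    also have "\<dots> < 1" using B by simp
    finally show False by simp
  qed
  then have fI: "f ` I \<inter> inside (f ` K) = {}"
    using connected_subset_inside[OF conI dI] J' bounded_subset by metis
  \<comment> \<open>The value \<open>0\<close> must be avoided: as \<open>inverse 0 = 0\<close>, it
    is taken by \<open>f\<close> only at the pole. A nonempty open set is not contained in a single
    point.\<close>
  have "\<not> inside (f ` K) \<subseteq> {0}"
    using J' by (metis finite.emptyI finite_insert finite_imp_not_open finite_subset)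
  then obtain w where w: "w \<in> inside (f ` K)" "w \<noteq> 0" by blast
  define y where "y = a + inverse w"
  have y: "f y = w" "y \<noteq> a" using w by (auto simp: f_def y_def)
  have "y \<notin> K" using w y inside_no_overlap[of "f ` K"] by blast
  moreover have "y \<notin> inside K" using fI w y by (auto simp: I_def)
  ultimately have yo: "y \<in> outside K" using io by blast
  have ao: "a \<notin> outside K" using io a by blast
  have "f ` outside K \<subseteq> inside (f ` K)"
  proof (rule connected_subset_inside)
    show "connected (f ` outside K)" using J cont[OF ao] by (intro connected_continuous_image) auto
    show "f ` outside K \<inter> f ` K = {}" using disj[OF _ ao] outside_no_overlap by blast
    show "f ` outside K \<inter> inside (f ` K) \<noteq> {}" using yo y w by blast
  qed
  moreover have "z \<in> I \<or> z \<in> outside K" using io z unfolding I_def by blast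
  moreover have "z \<in> outside K \<longleftrightarrow> z \<notin> inside K" using io z by blast
  ultimately show ?thesis using fI by blast
qed

context drawing begin

lemma inverted_drawing:
  assumes C: "is_cyc E C"
  obtains p' \<gamma>' where "drawing V E p' \<gamma>'"
    "drawing.InE E \<gamma>' C = E - C - InE C" "drawing.InV V p' \<gamma>' C = V - \<Union>C - InV C"
proof -
  obtain c where c: "simple_path c" "pathfinish c = pathstart c" "path_image c = img C"
    using cyc_curve[OF C] .
  note J = Jordan_inside_outside[OF c(1,2), unfolded c(3)]
  have CE: "C \<subseteq> E" using is_cyc_card(6)[OF C] .
  have fin: "finite (p ` V)" using simple_graph_finite(1)[OF simple] by simp
  \<comment> \<open>The centre must avoid the drawing so that all edges remain bounded arcs. The
    drawing has empty interior, while the inside of \<open>C\<close> is open and nonempty.\<close>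
  have "interior (img E \<union> p ` V) = {}"
    using img_closed_empty_interior[of E] empty_interior_finite[OF fin]
    by (simp add: interior_closed_Un_empty_interior)
  then have "\<not> inside (img C) \<subseteq> img E \<union> p ` V"
    using J interior_maximal by (metis subset_empty)
  then obtain a where a: "a \<in> inside (img C)" "a \<notin> img E" "a \<notin> p ` V" by blast
  define f where "f = (\<lambda>z. inverse (z - a))"
  have inj_f: "inj_on f (- {a})" by (auto simp: f_def inj_on_def)
  have cont: "continuous_on S f" if "a \<notin> S" for S
    unfolding f_def using that by (intro continuous_intros) auto
  have ae: "a \<notin> path_image (\<gamma> e)" if "e \<in> E" for e using a(2) that by (auto simp: img_def)
  have Int: "f ` S \<inter> f ` T = f ` (S \<inter> T)" if "a \<notin> S" "a \<notin> T" for S T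
    using inj_on_image_Int[OF inj_f, of S T] that by auto
  define p' where "p' = f \<circ> p"
  define \<gamma>' where "\<gamma>' = (\<lambda>e. f \<circ> \<gamma> e)"
  have pim: "path_image (\<gamma>' e) = f ` path_image (\<gamma> e)" for e
    by (simp add: \<gamma>'_def path_image_compose)
  have d: "drawing V E p' \<gamma>'"
  proof
    show "simple_graph V E" by (rule simple)
    show "inj_on p' V" unfolding p'_def
      by (rule comp_inj_on[OF inj]) (rule inj_on_subset[OF inj_f], use a in auto)
    fix e assume e: "e \<in> E"
    show "arc (\<gamma>' e)"
      unfolding \<gamma>'_def arc_def
    proof
      show "path (f \<circ> \<gamma> e)" using arc[OF e] cont[OF ae[OF e]]
        by (intro path_continuous_image) (auto simp: arc_imp_path)
      show "inj_on (f \<circ> \<gamma> e) {0..1}"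
        using arc[OF e] ae[OF e]
        by (intro comp_inj_on inj_on_subset[OF inj_f]) (auto simp: arc_def path_image_def)
    qed
    show "{pathstart (\<gamma>' e), pathfinish (\<gamma>' e)} = p' ` e"
      using arg_cong[OF ends[OF e], of "image f"]
      by (simp add: \<gamma>'_def p'_def pathstart_compose pathfinish_compose image_image)
    show "path_image (\<gamma>' e) \<inter> p' ` V = p' ` e"
      using Int[of "path_image (\<gamma> e)" "p ` V"] verts[OF e] ae[OF e] a
      by (simp add: pim p'_def image_comp)
  next
    fix e1 e2 assume e: "e1 \<in> E" "e2 \<in> E" "e1 \<noteq> e2"
    have "path_image (\<gamma>' e1) \<inter> path_image (\<gamma>' e2) = f ` (path_image (\<gamma> e1) \<inter> path_image (\<gamma> e2))"
      using Int ae e by (simp add: pim)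
    also have "\<dots> \<subseteq> f ` p ` (e1 \<inter> e2)" using cross[OF e] by (rule image_mono)
    finally show "path_image (\<gamma>' e1) \<inter> path_image (\<gamma>' e2) \<subseteq> p' ` (e1 \<inter> e2)"
      by (simp add: p'_def image_comp)
  qed
  interpret d': drawing V E p' \<gamma>' by (rule d)
  have img': "d'.img C = f ` img C" by (auto simp: d'.img_def img_def pim)
  obtain c' where c': "simple_path c'" "pathfinish c' = pathstart c'" "path_image c' = f ` img C"
    using d'.cyc_curve[OF C] img' by metis
  have side: "f z \<in> inside (d'.img C) \<longleftrightarrow> z \<notin> inside (img C)" if "z \<noteq> a" "z \<notin> img C" for z
    using inversion_swaps_sides[OF c c'[unfolded f_def] a(1) that] by (simp add: img' f_def)
  have mid': "d'.mid e = f (mid e)" for e unfolding d'.mid_def mid_def by (simp add: \<gamma>'_def)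
  have "e \<in> d'.InE C \<longleftrightarrow> e \<in> E - C - InE C" for e
  proof (cases "e \<in> E \<and> e \<notin> C")
    case True
    then have "mid e \<noteq> a" "mid e \<notin> img C" using ae[of e] mid_in[of e] img_mid[OF CE, of e] by auto
    then show ?thesis using True side[of "mid e"] by (simp add: d'.InE_def InE_def mid')
  next
    case False
    then show ?thesis using d'.InE_disjoint[OF CE] by (auto simp: d'.InE_def)
  qed
  then have iE: "d'.InE C = E - C - InE C" by blast
  have "v \<in> d'.InV C \<longleftrightarrow> v \<in> V - \<Union>C - InV C" for v
  proof (cases "v \<in> V \<and> v \<notin> \<Union>C")
    case True
    then have "p v \<noteq> a" "p v \<notin> img C" using a img_vertex[OF CE, of v] by auto
    then show ?thesis using True side[of "p v"] unfolding d'.InV_def InV_def by (simp add: p'_def)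
  next
    case False
    then show ?thesis using d'.InV_disjoint[OF CE] by (auto simp: d'.InV_def)
  qed
  then have iV: "d'.InV C = V - \<Union>C - InV C" by blast
  show thesis by (rule that[OF d iE iV])
qed

end

section \<open>Two-connectedness and ears\<close>

text \<open>Connectedness and the absence of cut vertices in one clause. Its negation directly
  yields the two parts to which \<open>few_triangles_edge_bound\<close> applies its induction
  hypothesis.\<close>

definition biconnected :: "'a set \<Rightarrow> 'a set set \<Rightarrow> bool" where
  "biconnected V E \<longleftrightarrow> (\<forall>V1 V2. V1 \<union> V2 = V \<and> V1 \<noteq> V \<and> V2 \<noteq> V \<and> card (V1 \<inter> V2) \<le> 1
     \<longrightarrow> (\<exists>e\<in>E. \<not> e \<subseteq> V1 \<and> \<not> e \<subseteq> V2))"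

text \<open>If all edges leaving \<open>R\<close> ended in \<open>u\<close>, then \<open>R\<close>
  with \<open>u\<close> and the complement of \<open>R\<close> would form a separation overlapping
  at most in \<open>u\<close>; the vertex \<open>t\<close> keeps the first of the two sets proper,
  and \<open>x\<close> the second.\<close>

lemma biconnectedE:
  assumes "biconnected V E" "simple_graph V E" "R \<subseteq> V" "x \<in> R" "t \<in> V" "t \<notin> R" "t \<noteq> u" "u \<notin> R"
  obtains v y where "v \<in> R" "y \<in> V" "y \<notin> R" "y \<noteq> u" "{v, y} \<in> E"
proof -
  let ?V1 = "V \<inter> (R \<union> {u})" and ?V2 = "V - R"
  have "?V1 \<inter> ?V2 \<subseteq> {u}" by auto
  then have "card (?V1 \<inter> ?V2) \<le> 1" using card_mono[of "{u}" "?V1 \<inter> ?V2"] by simp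
  moreover have "?V1 \<union> ?V2 = V" "?V1 \<noteq> V" "?V2 \<noteq> V" using assms by auto
  ultimately obtain e where e: "e \<in> E" "\<not> e \<subseteq> ?V1" "\<not> e \<subseteq> ?V2"
    using assms(1) unfolding biconnected_def by meson
  obtain s t where st: "e = {s, t}" "s \<in> V" "t \<in> V" using simple_graph_edgeE[OF assms(2) e(1)] by metis
  then have "s \<in> R \<and> t \<notin> R \<and> t \<noteq> u \<or> t \<in> R \<and> s \<notin> R \<and> s \<noteq> u" using e(2,3) by blast
  then show thesis using that[of s t] that[of t s] st e(1) by (auto simp: insert_commute)
qed

text \<open>\<open>R\<close> collects the vertices reachable from \<open>w\<close> outside
  \<open>S\<close>. By \<open>biconnectedE\<close> some edge leaves \<open>R\<close> without ending
  in \<open>u\<close>; its far end \<open>y\<close> would be in \<open>R\<close> if it were not in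
  \<open>S\<close>, so the ear returns to \<open>S\<close> at a vertex other than
  \<open>u\<close>.\<close>

lemma ear_exists:
  assumes bi: "biconnected V E" and simple: "simple_graph V E"
    and S: "S \<subseteq> V" "u \<in> S" "s \<in> S" "s \<noteq> u" and w: "w \<in> V" "w \<notin> S" "{u, w} \<in> E"
  obtains y ws where "y \<in> S" "y \<noteq> u" "w \<in> set ws" "set ws \<subseteq> V - S" "distinct ws"
    "path_edges (u # ws @ [y]) \<subseteq> E"
proof -
  define Q where "Q ws \<longleftrightarrow> distinct ws \<and> ws \<noteq> [] \<and> hd ws = w \<and> set ws \<subseteq> V - S \<and> path_edges ws \<subseteq> E" for ws
  define R where "R = last ` {ws. Q ws}"
  have RS: "R \<subseteq> V - S" unfolding R_def Q_def using last_in_set by fastforce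
  have "Q [w]" using w by (simp add: Q_def)
  then have wR: "w \<in> R" unfolding R_def by force
  obtain v y where vy: "v \<in> R" "y \<in> V" "y \<notin> R" "y \<noteq> u" "{v, y} \<in> E"
    using biconnectedE[OF bi simple, of R w s u] wR RS S by blast
  then obtain ws where ws: "Q ws" "last ws = v" unfolding R_def by blast
  have ext: "path_edges (ws @ [y]) \<subseteq> E"
  proof -
    have "ws = butlast ws @ [v]" using ws by (metis Q_def append_butlast_last_id)
    then have "path_edges (ws @ [y]) = path_edges ws \<union> path_edges [v, y]"
      by (metis append.assoc append_Cons append_Nil path_edges_append)
    then show ?thesis using ws vy by (simp add: Q_def)
  qed
  have "y \<in> S"
  proof (rule ccontr)
    assume "y \<notin> S"
    \<comment> \<open>A vertex already on \<open>ws\<close> is reached by a prefix of it, so here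
      \<open>ws\<close> can be prolonged by \<open>y\<close> without repetition.\<close>
    have "y \<notin> set ws"
    proof
      assume "y \<in> set ws"
      then obtain l r where lr: "ws = l @ y # r" by (auto dest: split_list)
      then have "path_edges (l @ [y]) \<subseteq> path_edges ws" using path_edges_append[of l y r] by auto
      moreover have "hd (l @ [y]) = hd ws" using lr by (cases l) auto
      ultimately have "Q (l @ [y])" using ws(1) lr by (auto simp: Q_def)
      then have "y \<in> R" unfolding R_def by force
      then show False using vy by simp
    qed
    then have "Q (ws @ [y])" using ws ext vy \<open>y \<notin> S\<close> by (auto simp: Q_def)
    then have "y \<in> R" unfolding R_def by force
    then show False using vy by simp
  qed
  moreover have "path_edges (u # ws @ [y]) = insert {u, w} (path_edges (ws @ [y]))"
    using ws path_edges_Cons[of "ws @ [y]" u] by (auto simp: Q_def)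
  moreover have "w \<in> set ws" using ws by (auto simp: Q_def)
  ultimately show thesis using that[of y ws] vy ws ext w by (auto simp: Q_def)
qed

text \<open>An ear on the set \<open>{u, v}\<close> starting with \<open>{u, w}\<close> can only
  return at \<open>v\<close>, and the edge \<open>{u, v}\<close> closes it.\<close>

lemma cycle_exists:
  assumes bi: "biconnected V E" and simple: "simple_graph V E" and "{u, v} \<in> E" "{u, w} \<in> E" "v \<noteq> w"
  obtains C where "is_cyc E C"
proof -
  have V: "u \<in> V" "v \<in> V" "w \<in> V" "u \<noteq> v" "u \<noteq> w"
    using simple_graph_edgeE[OF simple assms(3)] simple_graph_edgeE[OF simple assms(4)]
    by (metis doubleton_eq_iff)+
  obtain y ws where y: "y \<in> {u, v}" "y \<noteq> u" "w \<in> set ws" "set ws \<subseteq> V - {u, v}" "distinct ws"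
    "path_edges (u # ws @ [y]) \<subseteq> E"
    using ear_exists[OF bi simple, of "{u,v}" u v w] V assms by auto
  have "is_cyc E (path_edges (u # ws @ [v]) \<union> path_edges (u # [] @ [v]))"
    using y V assms(3) by (intro is_cyc_twoI) auto
  then show thesis by (rule that)
qed

section \<open>Faces and the Euler formula\<close>

text \<open>The members of \<open>F\<close> at \<open>y\<close>, two of them being joined when they share an edge at \<open>y\<close>, form a
  connected graph. This is what makes two faces sharing two edges at \<open>y\<close> force \<open>y\<close> to have degree 2.\<close>

definition link_connected :: "'a set set set \<Rightarrow> 'a \<Rightarrow> bool" where
  "link_connected F y \<longleftrightarrow> (\<forall>S\<subseteq>F.
     (\<forall>D\<in>S. \<forall>D'\<in>F. \<forall>e. y \<in> e \<and> e \<in> D \<and> e \<in> D' \<longrightarrow> D' \<in> S) \<longrightarrow>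
     (\<forall>D\<in>F. y \<in> \<Union>D \<longrightarrow> D \<in> S) \<or> (\<forall>D\<in>F. y \<in> \<Union>D \<longrightarrow> D \<notin> S))"

text \<open>A set closed under sharing edges at \<open>y\<close> contains, in each family, all or
  none of the members at \<open>y\<close>. If both families have members at \<open>y\<close>, the
  common edge makes the two choices agree; otherwise at most one family has a choice to
  make.\<close>

lemma link_connected_Un:
  assumes 1: "link_connected F1 y" and 2: "link_connected F2 y"
    and e: "\<And>D1 D2. D1 \<in> F1 \<Longrightarrow> D2 \<in> F2 \<Longrightarrow> y \<in> \<Union>D1 \<Longrightarrow> y \<in> \<Union>D2 \<Longrightarrow>
      \<exists>e. y \<in> e \<and> (\<exists>D\<in>F1. e \<in> D) \<and> (\<exists>D\<in>F2. e \<in> D)"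
  shows "link_connected (F1 \<union> F2) y"
  unfolding link_connected_def
proof (intro allI impI)
  fix S assume S: "S \<subseteq> F1 \<union> F2"
    and cl: "\<forall>D\<in>S. \<forall>D'\<in>F1 \<union> F2. \<forall>e. y \<in> e \<and> e \<in> D \<and> e \<in> D' \<longrightarrow> D' \<in> S"
  have a1: "(\<forall>D\<in>F1. y \<in> \<Union>D \<longrightarrow> D \<in> S \<inter> F1) \<or> (\<forall>D\<in>F1. y \<in> \<Union>D \<longrightarrow> D \<notin> S \<inter> F1)"
  proof (rule 1[unfolded link_connected_def, rule_format])
    show "S \<inter> F1 \<subseteq> F1" by blast
  qed (use cl in blast)
  have a2: "(\<forall>D\<in>F2. y \<in> \<Union>D \<longrightarrow> D \<in> S \<inter> F2) \<or> (\<forall>D\<in>F2. y \<in> \<Union>D \<longrightarrow> D \<notin> S \<inter> F2)"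
  proof (rule 2[unfolded link_connected_def, rule_format])
    show "S \<inter> F2 \<subseteq> F2" by blast
  qed (use cl in blast)
  show "(\<forall>D\<in>F1 \<union> F2. y \<in> \<Union>D \<longrightarrow> D \<in> S) \<or> (\<forall>D\<in>F1 \<union> F2. y \<in> \<Union>D \<longrightarrow> D \<notin> S)"
  proof (cases "\<exists>D1\<in>F1. \<exists>D2\<in>F2. y \<in> \<Union>D1 \<and> y \<in> \<Union>D2")
    case True
    then obtain e0 G1 G2 where g: "y \<in> e0" "G1 \<in> F1" "e0 \<in> G1" "G2 \<in> F2" "e0 \<in> G2"
      using e by metis
    then have "G1 \<in> S \<longleftrightarrow> G2 \<in> S" using cl by blast
    moreover have "y \<in> \<Union>G1" "y \<in> \<Union>G2" using g by blast+
    ultimately show ?thesis using a1 a2 g(2,4) by (metis IntD1 IntI UnE)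
  next
    case False
    then show ?thesis using a1 a2 by (metis IntD1 IntI UnE)
  qed
qed

text \<open>A family of cycles that tiles a disc with boundary cycle \<open>C\<close>, interior edges \<open>I\<close> and
  interior vertices \<open>J\<close>.\<close>

definition tiling :: "'a set set \<Rightarrow> 'a set set \<Rightarrow> 'a set set \<Rightarrow> 'a set \<Rightarrow> 'a set set set \<Rightarrow> bool" where
  "tiling E C I J F \<longleftrightarrow> finite F \<and>
     (\<forall>D\<in>F. is_cyc E D \<and> D \<subseteq> C \<union> I \<and> \<Union>D \<subseteq> \<Union>C \<union> J) \<and>
     (\<forall>e\<in>I. card {D \<in> F. e \<in> D} = 2) \<and> (\<forall>e\<in>C. card {D \<in> F. e \<in> D} = 1) \<and>
     card F + card J = card I + 1 \<and>
     (I = {} \<longrightarrow> F = {C}) \<and> (I \<noteq> {} \<longrightarrow> (\<forall>D\<in>F. D \<inter> I \<noteq> {})) \<and>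
     (\<forall>y. link_connected F y)"

text \<open>Gluing is used twice: along an ear inside a cycle, and along a whole cycle to join its
  two sides. A common boundary edge is counted once on each side and becomes interior. The
  hypothesis \<open>ne\<close> excludes the case in which both families consist of the same single
  cycle.\<close>

lemma tiling_glue:
  assumes 1: "tiling E C1 I1 J1 F1" and 2: "tiling E C2 I2 J2 F2"
    and d: "I1 \<inter> C1 = {}" "I1 \<inter> C2 = {}" "I1 \<inter> I2 = {}" "I2 \<inter> C1 = {}" "I2 \<inter> C2 = {}"
    and v: "(\<Union>C1 \<union> J1) \<inter> (\<Union>C2 \<union> J2) \<subseteq> \<Union>(C1 \<inter> C2)"
    and ne: "\<not> (C1 = C2 \<and> I1 = {} \<and> I2 = {})"
  shows "card (F1 \<union> F2) = card F1 + card F2"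
    and "\<And>e. e \<in> I1 \<union> I2 \<union> (C1 \<inter> C2) \<Longrightarrow> card {D \<in> F1 \<union> F2. e \<in> D} = 2"
    and "\<And>e. e \<in> (C1 - C2) \<union> (C2 - C1) \<Longrightarrow> card {D \<in> F1 \<union> F2. e \<in> D} = 1"
    and "link_connected (F1 \<union> F2) y"
proof -
  have fin: "finite F1" "finite F2" using 1 2 by (simp_all add: tiling_def)
  have s1: "D \<subseteq> C1 \<union> I1" "\<Union>D \<subseteq> \<Union>C1 \<union> J1" if "D \<in> F1" for D using 1 that by (simp_all add: tiling_def)
  have s2: "D \<subseteq> C2 \<union> I2" "\<Union>D \<subseteq> \<Union>C2 \<union> J2" if "D \<in> F2" for D using 2 that by (simp_all add: tiling_def)
  have n1: "I1 \<noteq> {} \<Longrightarrow> D \<in> F1 \<Longrightarrow> D \<inter> I1 \<noteq> {}" "I1 = {} \<Longrightarrow> F1 = {C1}" for D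
    using 1 by (simp_all add: tiling_def)
  have n2: "I2 \<noteq> {} \<Longrightarrow> D \<in> F2 \<Longrightarrow> D \<inter> I2 \<noteq> {}" "I2 = {} \<Longrightarrow> F2 = {C2}" for D
    using 2 by (simp_all add: tiling_def)
  \<comment> \<open>A common member has no interior edge of either side, so by \<open>n1\<close> and
    \<open>n2\<close> neither side has interior edges and each family is just its boundary
    cycle.\<close>
  have disj: "F1 \<inter> F2 = {}"
  proof (rule ccontr)
    assume "F1 \<inter> F2 \<noteq> {}"
    then obtain D where D: "D \<in> F1" "D \<in> F2" by blast
    have "I1 = {}"
    proof (rule ccontr)
      assume "I1 \<noteq> {}"
      then have "D \<inter> I1 \<noteq> {}" using n1(1) D by simp
      then show False using s2(1)[OF D(2)] d by blast
    qed
    moreover have "I2 = {}"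
    proof (rule ccontr)
      assume "I2 \<noteq> {}"
      then have "D \<inter> I2 \<noteq> {}" using n2(1) D by simp
      then show False using s1(1)[OF D(1)] d by blast
    qed
    ultimately show False using n1(2) n2(2) D ne by simp
  qed
  show "card (F1 \<union> F2) = card F1 + card F2" using card_Un_disjoint[OF fin disj] .
  have sum: "card {D \<in> F1 \<union> F2. e \<in> D} = card {D \<in> F1. e \<in> D} + card {D \<in> F2. e \<in> D}" for e
  proof -
    have "{D \<in> F1 \<union> F2. e \<in> D} = {D \<in> F1. e \<in> D} \<union> {D \<in> F2. e \<in> D}" by blast
    then show ?thesis using card_Un_disjoint[of "{D \<in> F1. e \<in> D}" "{D \<in> F2. e \<in> D}"] fin disj by auto
  qed
  have z1: "card {D \<in> F1. e \<in> D} = 0" if "e \<notin> C1 \<union> I1" for e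
  proof -
    have "{D \<in> F1. e \<in> D} = {}" using s1(1) that by blast
    then show ?thesis by (metis card.empty)
  qed
  have z2: "card {D \<in> F2. e \<in> D} = 0" if "e \<notin> C2 \<union> I2" for e
  proof -
    have "{D \<in> F2. e \<in> D} = {}" using s2(1) that by blast
    then show ?thesis by (metis card.empty)
  qed
  have i1: "e \<in> I1 \<Longrightarrow> card {D \<in> F1. e \<in> D} = 2" "e \<in> C1 \<Longrightarrow> card {D \<in> F1. e \<in> D} = 1" for e
    using 1 by (simp_all add: tiling_def)
  have i2: "e \<in> I2 \<Longrightarrow> card {D \<in> F2. e \<in> D} = 2" "e \<in> C2 \<Longrightarrow> card {D \<in> F2. e \<in> D} = 1" for e
    using 2 by (simp_all add: tiling_def)
  have x: "e \<in> I1 \<Longrightarrow> e \<notin> C2 \<union> I2" "e \<in> I2 \<Longrightarrow> e \<notin> C1 \<union> I1" for e using d by blast+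
  show "card {D \<in> F1 \<union> F2. e \<in> D} = 2" if e: "e \<in> I1 \<union> I2 \<union> (C1 \<inter> C2)" for e
  proof -
    consider "e \<in> I1" | "e \<in> I2" | "e \<in> C1" "e \<in> C2" using e by blast
    then show ?thesis
    proof cases
      case 1 then show ?thesis using sum[of e] i1(1)[of e] z2[of e] x(1)[of e] by simp
    next
      case 2 then show ?thesis using sum[of e] i2(1)[of e] z1[of e] x(2)[of e] by simp
    next
      case 3 then show ?thesis using sum[of e] i1(2)[of e] i2(2)[of e] by simp
    qed
  qed
  show "card {D \<in> F1 \<union> F2. e \<in> D} = 1" if e: "e \<in> (C1 - C2) \<union> (C2 - C1)" for e
  proof -
    consider "e \<in> C1" "e \<notin> C2 \<union> I2" | "e \<in> C2" "e \<notin> C1 \<union> I1" using e x[of e] by blast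
    then show ?thesis
    proof cases
      case 1 then show ?thesis using sum[of e] i1(2)[of e] z2[of e] by simp
    next
      case 2 then show ?thesis using sum[of e] i2(2)[of e] z1[of e] by simp
    qed
  qed
  show "link_connected (F1 \<union> F2) y"
  proof (rule link_connected_Un)
    show "link_connected F1 y" "link_connected F2 y" using 1 2 by (simp_all add: tiling_def)
    fix D1 D2 assume D: "D1 \<in> F1" "D2 \<in> F2" "y \<in> \<Union>D1" "y \<in> \<Union>D2"
    \<comment> \<open>By \<open>v\<close> a common vertex lies on a common boundary edge, and such
      an edge belongs to one member on each side; it is the bridge between the two links.\<close>
    then have "y \<in> \<Union>(C1 \<inter> C2)" using s1(2)[OF D(1)] s2(2)[OF D(2)] v by blast
    then obtain e where e: "y \<in> e" "e \<in> C1" "e \<in> C2" by blast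
    have "{D \<in> F1. e \<in> D} \<noteq> {}" "{D \<in> F2. e \<in> D} \<noteq> {}" using i1(2)[OF e(2)] i2(2)[OF e(3)] by force+
    then show "\<exists>e. y \<in> e \<and> (\<exists>D\<in>F1. e \<in> D) \<and> (\<exists>D\<in>F2. e \<in> D)" using e by blast
  qed
qed

section \<open>Tiling the inside of a cycle\<close>

context drawing begin

text \<open>A chord inside \<open>C\<close> is an ear already. Otherwise some inner edge has an end
  off \<open>C\<close>, which is an inner vertex; two-connectedness gives an edge from an inner
  vertex to \<open>C\<close>, and \<open>ear_exists\<close> continues it to another vertex of
  \<open>C\<close>.\<close>

lemma ear_inside:
  assumes bi: "biconnected V E" and C: "is_cyc E C" and ne: "InE C \<noteq> {}"
  obtains a b zs where "a \<in> \<Union>C" "b \<in> \<Union>C" "distinct (a # b # zs)" "set zs \<inter> \<Union>C = {}"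
    "path_edges (a # zs @ [b]) \<subseteq> E" "path_edges (a # zs @ [b]) \<inter> C = {}"
    "path_edges (a # zs @ [b]) \<inter> InE C \<noteq> {} \<or> set zs \<inter> InV C \<noteq> {}"
proof (cases "\<exists>e\<in>InE C. e \<subseteq> \<Union>C")
  case True
  then obtain e where e: "e \<in> InE C" "e \<subseteq> \<Union>C" by blast
  have eE: "e \<in> E" "e \<notin> C" using e InE_disjoint[OF is_cyc_card(6)[OF C]] by (auto simp: InE_def)
  obtain a b where "e = {a, b}" "a \<noteq> b" using simple_graph_edgeE[OF simple eE(1)] by metis
  then show ?thesis using that[of a b "[]"] e eE by simp
next
  case False
  have CE: "C \<subseteq> E" by (rule is_cyc_card(6)[OF C])
  note dV = InV_disjoint[OF CE] and dE = InE_disjoint[OF CE]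
  obtain e x where e: "e \<in> InE C" "x \<in> e" "x \<notin> \<Union>C" using False ne by blast
  then have xin: "x \<in> InV C" using edge_side[OF CE, of e x] dE by (auto simp: InE_def)
  obtain t where t: "t \<in> \<Union>C" "t \<in> V"
    using is_cyc_card(4)[OF C] is_cyc_card(3)[OF C] CE edge_sub
    by (metis Sup_least all_not_in_conv card.empty not_numeral_le_zero subset_iff)
  have sub: "InV C \<subseteq> V" by (auto simp: InV_def)
  have tn: "t \<notin> InV C" using t(1) dV by blast
  have "\<not> \<Union>C \<subseteq> {t}" using card_mono[of "{t}" "\<Union>C"] is_cyc_card(3,4)[OF C] by auto
  then obtain r where "r \<in> \<Union>C" and r1: "t \<noteq> r" by auto
  then have r: "t \<noteq> r" "r \<notin> InV C" using dV disjoint_iff by metis+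
  obtain w u where wu: "w \<in> InV C" "u \<in> V" "u \<notin> InV C" "u \<noteq> r" "{w, u} \<in> E"
    using biconnectedE[OF bi simple sub xin t(2) tn r] .
  have wC: "w \<notin> \<Union>C" using wu(1) dV disjoint_iff by metis
  then have nC: "{w, u} \<notin> C" by blast
  \<comment> \<open>An edge with both ends off \<open>C\<close> has both on the side of its
    midpoint, so an edge leaving \<open>InV C\<close> ends on \<open>C\<close>.\<close>
  have uC: "u \<in> \<Union>C"
  proof (rule ccontr)
    assume "u \<notin> \<Union>C"
    then have "u \<in> InV C \<longleftrightarrow> {w,u} \<in> InE C" using edge_side[OF CE wu(5) nC, of u] by simp
    moreover have "w \<in> InV C \<longleftrightarrow> {w,u} \<in> InE C" using edge_side[OF CE wu(5) nC, of w] wC by simp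
    ultimately show False using wu by simp
  qed
  have "\<not> \<Union>C \<subseteq> {u}" using card_mono[of "{u}" "\<Union>C"] is_cyc_card(3,4)[OF C] by auto
  then obtain s where s: "s \<in> \<Union>C" "s \<noteq> u" by auto
  have CV: "\<Union>C \<subseteq> V" using CE edge_sub by blast
  obtain y ws where y: "y \<in> \<Union>C" "y \<noteq> u" "w \<in> set ws" "set ws \<subseteq> V - \<Union>C" "distinct ws"
    "path_edges (u # ws @ [y]) \<subseteq> E"
    using ear_exists[OF bi simple CV uC s, of w] wu wC by (auto simp: InV_def insert_commute)
  have dist: "distinct (u # ws @ [y])" using y uC by auto
  have "path_edges (u # ws @ [y]) \<inter> C = {}"
  proof (rule ccontr)
    assume "path_edges (u # ws @ [y]) \<inter> C \<noteq> {}"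
    then obtain e where e: "e \<in> path_edges (u # ws @ [y])" "e \<in> C" by blast
    have "e \<subseteq> {u, y}" using path_edges_subset[OF e(1)] e(2) y(4) by auto
    moreover obtain x x' where "e = {x, x'}" "x \<noteq> x'" using path_edges_no_self[OF dist e(1)] by blast
    ultimately have "e = {u, y}" by auto
    then show False using path_edges_ends[OF dist] e y(3) by simp
  qed
  then show ?thesis using that[of u y ws] y uC wu by auto
qed

theorem tiling_exists:
  assumes bi: "biconnected V E" and deg: "\<forall>v\<in>V. \<exists>e\<in>E. v \<in> e" and C: "is_cyc E C"
  shows "\<exists>F. tiling E C (InE C) (InV C) F"
  using C
proof (induction "card (InE C)" arbitrary: C rule: less_induct)
  case less
  note C = less.prems
  have CE: "C \<subseteq> E" by (rule is_cyc_card(6)[OF C])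
  have finE: "finite (InE D)" for D using simple_graph_finite[OF simple] by (simp add: InE_def)
  have finV: "finite (InV D)" for D using simple_graph_finite[OF simple] by (simp add: InV_def)
  show ?case
  proof (cases "InE C = {}")
    case True
    \<comment> \<open>By \<open>deg\<close> a vertex inside has an incident edge, which lies inside
      by \<open>edge_side\<close>; without inner edges there are thus no inner vertices.\<close>
    have "InV C = {}"
    proof (rule ccontr)
      assume "InV C \<noteq> {}"
      then obtain x where x: "x \<in> InV C" by blast
      then obtain e where e: "e \<in> E" "x \<in> e" using deg by (auto simp: InV_def)
      have "x \<notin> \<Union>C" using x InV_disjoint[OF CE] by blast
      then show False using edge_side[OF CE e(1) _ e(2)] x e True by blast
    qed
    moreover have "{D \<in> {C}. e \<in> D} = {C}" if "e \<in> C" for e using that by auto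
    ultimately have "tiling E C (InE C) (InV C) {C}"
      using C True by (simp add: tiling_def link_connected_def)
    then show ?thesis by blast
  next
    case False
    obtain a b zs where ear: "a \<in> \<Union>C" "b \<in> \<Union>C" "distinct (a # b # zs)" "set zs \<inter> \<Union>C = {}"
      "path_edges (a # zs @ [b]) \<subseteq> E" "path_edges (a # zs @ [b]) \<inter> C = {}"
      "path_edges (a # zs @ [b]) \<inter> InE C \<noteq> {} \<or> set zs \<inter> InV C \<noteq> {}"
      using ear_inside[OF bi C False] .
    have "a \<noteq> b" using ear(3) by simp
    obtain xs ys where two: "distinct (a # b # xs @ ys)" "xs \<noteq> [] \<or> ys \<noteq> []"
      "C = path_edges (a # xs @ [b]) \<union> path_edges (a # ys @ [b])"
      using is_cyc_twoE[OF C ear(1,2) \<open>a \<noteq> b\<close>] .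
    define A where "A = path_edges (a # xs @ [b])"
    define B where "B = path_edges (a # ys @ [b])"
    define P where "P = path_edges (a # zs @ [b])"
    have CAB: "C = A \<union> B" using two by (simp add: A_def B_def)
    have UA: "\<Union>A = {a, b} \<union> set xs" using Union_path_edges[of "xs @ [b]" a] unfolding A_def by auto
    have UB: "\<Union>B = {a, b} \<union> set ys" using Union_path_edges[of "ys @ [b]" a] unfolding B_def by auto
    have UP: "\<Union>P = {a, b} \<union> set zs" using Union_path_edges[of "zs @ [b]" a] unfolding P_def by auto
    \<comment> \<open>If the ear is the single edge \<open>{a, b}\<close>, neither arc of
      \<open>C\<close> is, since the ear has no edge in \<open>C\<close>.\<close>
    have ne: "xs \<noteq> [] \<or> zs \<noteq> []" "ys \<noteq> [] \<or> zs \<noteq> []"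
      using ear(6) two(3) by (cases "zs = []"; cases "xs = []"; cases "ys = []"; auto)+
    have dist: "distinct (a # b # xs @ ys @ zs)"
      using two(1) ear(3,4) UA UB CAB by auto
    have sub: "A \<subseteq> E" "B \<subseteq> E" "P \<subseteq> E" using CAB CE ear(5) by (auto simp: P_def)
    have dAB: "A \<inter> B = {}" using path_edges_disjoint[OF two(1,2)] by (simp add: A_def B_def)
    have dP: "P \<inter> A = {}" "P \<inter> B = {}" using ear(6) CAB by (auto simp: P_def)
    have ins: "P \<inter> InE (A \<union> B) \<noteq> {} \<or> set zs \<inter> InV (A \<union> B) \<noteq> {}"
      using ear(7) CAB by (simp add: P_def)
    note th = theta_split[of a b xs ys zs, folded A_def B_def P_def, OF dist two(2) ne sub ins, folded CAB]
    let ?C1 = "A \<union> P" and ?C2 = "B \<union> P"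
    have cyc1: "is_cyc E ?C1" unfolding A_def P_def
      using dist ne sub by (intro is_cyc_twoI) (auto simp: A_def P_def)
    have cyc2: "is_cyc E ?C2" unfolding B_def P_def
      using dist ne sub by (intro is_cyc_twoI) (auto simp: B_def P_def)
    have C1E: "?C1 \<subseteq> E" "?C2 \<subseteq> E" using sub by auto
    have Pne: "P \<noteq> {}" "A \<noteq> {}" using UP UA by auto
    note dE = InE_disjoint[OF C1E(1)] InE_disjoint[OF C1E(2)] InE_disjoint[OF CE]
    note dV = InV_disjoint[OF C1E(1)] InV_disjoint[OF C1E(2)] InV_disjoint[OF CE]
    \<comment> \<open>The induction measure drops strictly: the edges of \<open>P\<close> are inside
      \<open>C\<close> but on the boundary of both new cycles.\<close>
    have "InE ?C1 \<subset> InE C" "InE ?C2 \<subset> InE C" using th(1) dE Pne by blast+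
    then have "card (InE ?C1) < card (InE C)" "card (InE ?C2) < card (InE C)"
      using finE psubset_card_mono by blast+
    then obtain F1 F2 where F: "tiling E ?C1 (InE ?C1) (InV ?C1) F1" "tiling E ?C2 (InE ?C2) (InV ?C2) F2"
      using less.hyps cyc1 cyc2 by blast
    have P12: "?C1 \<inter> ?C2 = P" using dAB dP by blast
    have g1: "InE ?C1 \<inter> ?C2 = {}" using th(1) dE CAB by blast
    have g2: "InE ?C2 \<inter> ?C1 = {}" using th(1) dE CAB by blast
    have VP: "InV ?C1 \<inter> \<Union>P = {}" "InV ?C2 \<inter> \<Union>P = {}"
      using dV(1,2) unfolding Union_Un_distrib by blast+
    have v: "(\<Union>?C1 \<union> InV ?C1) \<inter> (\<Union>?C2 \<union> InV ?C2) \<subseteq> \<Union>(?C1 \<inter> ?C2)"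
    proof -
      have AB: "\<Union>A \<inter> \<Union>B \<subseteq> \<Union>P" using UA UB UP two(1) by auto
      have "InV ?C1 \<subseteq> InV C" "InV ?C2 \<subseteq> InV C" using th(2) by blast+
      then have "InV ?C1 \<inter> (\<Union>A \<union> \<Union>B) = {}" "InV ?C2 \<inter> (\<Union>A \<union> \<Union>B) = {}"
        using dV(3) unfolding CAB Union_Un_distrib by blast+
      then show ?thesis unfolding P12 Union_Un_distrib using AB th(4) VP
        by (auto simp del: Union_iff)
    qed
    have "?C1 \<noteq> ?C2" using Pne dAB dP by blast
    then have n: "\<not> (?C1 = ?C2 \<and> InE ?C1 = {} \<and> InE ?C2 = {})" by simp
    note glue = tiling_glue[OF F dE(1) g1 th(3) g2 dE(2) v n]
    have c1: "card F1 + card (InV ?C1) = card (InE ?C1) + 1" "card F2 + card (InV ?C2) = card (InE ?C2) + 1"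
      using F by (simp_all add: tiling_def)
    have cE: "card (InE C) = card (InE ?C1) + card (InE ?C2) + card P"
    proof -
      have "finite P" by (simp add: P_def)
      moreover have "(InE ?C1 \<union> InE ?C2) \<inter> P = {}" using dE by blast
      ultimately show ?thesis unfolding th(1) using finE th(3) by (simp add: card_Un_disjoint)
    qed
    have cV: "card (InV C) = card (InV ?C1) + card (InV ?C2) + length zs"
    proof -
      have "(InV ?C1 \<union> InV ?C2) \<inter> set zs = {}" using VP unfolding UP by blast
      then show ?thesis unfolding th(2) using finV th(4) ear(3) by (simp add: card_Un_disjoint distinct_card)
    qed
    \<comment> \<open>The ear has one edge more than it has inner vertices. This surplus absorbs the
      extra \<open>1\<close> when the Euler relations of the two parts are added.\<close>
    have cP: "card P = length zs + 1" unfolding P_def using card_path_edges[of a "zs @ [b]"] ear(3) by auto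
    have "tiling E C (InE C) (InV C) (F1 \<union> F2)"
      unfolding tiling_def
    proof (intro conjI ballI impI allI)
      show "finite (F1 \<union> F2)" using F by (simp add: tiling_def)
      fix D assume D: "D \<in> F1 \<union> F2"
      show "is_cyc E D" using D F unfolding tiling_def by (metis UnE)
      have D1: "D \<subseteq> ?C1 \<union> InE ?C1 \<and> \<Union>D \<subseteq> \<Union>?C1 \<union> InV ?C1 \<and> (D \<inter> InE ?C1 \<noteq> {} \<or> D = ?C1)" if "D \<in> F1"
        using that F(1) unfolding tiling_def by (metis singletonD)
      have D2: "D \<subseteq> ?C2 \<union> InE ?C2 \<and> \<Union>D \<subseteq> \<Union>?C2 \<union> InV ?C2 \<and> (D \<inter> InE ?C2 \<noteq> {} \<or> D = ?C2)" if "D \<in> F2"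
        using that F(2) unfolding tiling_def by (metis singletonD)
      have "D \<subseteq> ?C1 \<union> InE ?C1 \<or> D \<subseteq> ?C2 \<union> InE ?C2" using D D1 D2 by (metis UnE)
      then show "D \<subseteq> C \<union> InE C" using th(1) CAB by blast
      have "\<Union>D \<subseteq> \<Union>?C1 \<union> InV ?C1 \<or> \<Union>D \<subseteq> \<Union>?C2 \<union> InV ?C2" using D D1 D2 by (metis UnE)
      moreover have "X \<subseteq> Y \<union> I" if "X \<subseteq> Y1 \<union> I1 \<or> X \<subseteq> Y2 \<union> I2" "I = I1 \<union> I2 \<union> Z"
        "Y1 \<union> Y2 \<subseteq> Y \<union> Z" for X Y Y1 Y2 I I1 I2 Z :: "'a set" using that by blast
      moreover have "\<Union>?C1 \<union> \<Union>?C2 \<subseteq> \<Union>C \<union> set zs" using UP UA UB ear(1,2) CAB by auto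
      ultimately show "\<Union>D \<subseteq> \<Union>C \<union> InV C" using th(2) by metis
      have "D \<inter> InE ?C1 \<noteq> {} \<or> D \<inter> InE ?C2 \<noteq> {} \<or> D = ?C1 \<or> D = ?C2" using D D1 D2 by (metis UnE)
      then show "D \<inter> InE C \<noteq> {}" using th(1) Pne by blast
    next
      fix e assume "e \<in> InE C"
      then show "card {D \<in> F1 \<union> F2. e \<in> D} = 2" using th(1) P12 by (intro glue(2)) auto
    next
      fix e assume "e \<in> C"
      then show "card {D \<in> F1 \<union> F2. e \<in> D} = 1" using CAB dAB dP by (intro glue(3)) blast
    next
      show "card (F1 \<union> F2) + card (InV C) = card (InE C) + 1"
        using glue(1) c1 cE cV cP by simp
    next
      assume "InE C = {}" then show "F1 \<union> F2 = {C}" using False by simp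
    next
      fix y show "link_connected (F1 \<union> F2) y" by (rule glue(4))
    qed
    then show ?thesis by blast
  qed
qed

end

section \<open>Faces of a plane graph and Euler's formula\<close>

text \<open>The inside of a cycle \<open>C\<close> and, through the inverted drawing, its outside
  are tiled and glued along \<open>C\<close>. Since \<open>C\<close> has as many vertices as edges,
  adding the two Euler relations gives the formula for the sphere.\<close>

lemma planar_faces_exist:
  assumes "planar_graph V E" and simple: "simple_graph V E" and bi: "biconnected V E"
    and "V \<noteq> {}" and deg: "\<forall>v\<in>V. 3 \<le> card {e \<in> E. v \<in> e}"
  shows "\<exists>F. finite F \<and> (\<forall>D\<in>F. is_cyc E D) \<and> (\<forall>e\<in>E. card {D \<in> F. e \<in> D} = 2) \<and>
    card F + card V = card E + 2 \<and> (\<forall>y. link_connected F y)"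
proof -
  obtain p \<gamma> where "drawing V E p \<gamma>" using planar_drawing[OF simple assms(1)] .
  then interpret drawing V E p \<gamma> .
  have deg1: "\<forall>v\<in>V. \<exists>e\<in>E. v \<in> e"
  proof (rule ballI, rule ccontr)
    fix v assume "v \<in> V" "\<not> (\<exists>e\<in>E. v \<in> e)"
    then have "{e \<in> E. v \<in> e} = {}" by blast
    then have "card {e \<in> E. v \<in> e} = 0" by (metis card.empty)
    moreover have "3 \<le> card {e \<in> E. v \<in> e}" using deg \<open>v \<in> V\<close> by (rule bspec)
    ultimately show False by linarith
  qed
  obtain C where C: "is_cyc E C"
  proof -
    obtain u where u: "u \<in> V" using assms(4) by auto
    have "3 \<le> card {e \<in> E. u \<in> e}" using deg u by (rule bspec)
    then have "Suc (Suc 0) \<le> card {e \<in> E. u \<in> e}" by linarith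
    then obtain e1 T where T: "{e \<in> E. u \<in> e} = insert e1 T" "e1 \<notin> T" "Suc 0 \<le> card T"
      unfolding card_le_Suc_iff by auto
    then obtain e2 where "e2 \<in> T" by fastforce
    then have e: "e1 \<in> E" "e2 \<in> E" "u \<in> e1" "u \<in> e2" "e1 \<noteq> e2" using T by auto
    obtain v where "e1 = {u, v}" using simple_graph_edgeE[OF simple e(1)] e(3) by (metis insert_commute insert_iff singletonD)
    moreover obtain w where "e2 = {u, w}" using simple_graph_edgeE[OF simple e(2)] e(4) by (metis insert_commute insert_iff singletonD)
    ultimately show thesis using cycle_exists[OF bi simple, of u v w] that e by metis
  qed
  have CE: "C \<subseteq> E" by (rule is_cyc_card(6)[OF C])
  obtain p' \<gamma>' where d': "drawing V E p' \<gamma>'"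
    "drawing.InE E \<gamma>' C = E - C - InE C" "drawing.InV V p' \<gamma>' C = V - \<Union>C - InV C"
    using inverted_drawing[OF C] .
  obtain F1 where F1: "tiling E C (InE C) (InV C) F1" using tiling_exists[OF bi deg1 C] by blast
  obtain F2 where F2: "tiling E C (E - C - InE C) (V - \<Union>C - InV C) F2"
    using drawing.tiling_exists[OF d'(1) bi deg1 C] d'(2,3) by auto
  have dE: "InE C \<inter> C = {}" and dV: "InV C \<inter> \<Union>C = {}"
    using InE_disjoint[OF CE] InV_disjoint[OF CE] by auto
  have subE: "InE C \<subseteq> E" and subV: "InV C \<subseteq> V" by (auto simp: InE_def InV_def)
  \<comment> \<open>If the graph were just a cycle, both tilings would be \<open>{C}\<close> and the
    two faces would coincide as edge sets. The degree condition prevents this.\<close>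
  have "C \<noteq> E"
  proof
    assume "C = E"
    have "\<Union>C \<noteq> {}"
    proof
      assume "\<Union>C = {}"
      then have "card (\<Union>C) = 0" by (metis card.empty)
      then show False using is_cyc_card(3,4)[OF C] by linarith
    qed
    then obtain y where y: "y \<in> \<Union>C" by auto
    obtain e1 e2 where "{e \<in> E. y \<in> e} = {e1, e2}"
      using is_cyc_incident[OF C y] unfolding \<open>C = E\<close> by metis
    moreover have "card {e1, e2} \<le> 2" by (simp add: card_insert_if)
    ultimately have "card {e \<in> E. y \<in> e} \<le> 2" by metis
    moreover have "y \<in> V" using y simple_graph_finite(3)[OF simple] unfolding \<open>C = E\<close> by (rule rev_subsetD)
    then have "3 \<le> card {e \<in> E. y \<in> e}" using deg by simp
    ultimately show False by linarith
  qed
  then have n: "\<not> (C = C \<and> InE C = {} \<and> E - C - InE C = {})" using CE by blast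
  have v: "(\<Union>C \<union> InV C) \<inter> (\<Union>C \<union> (V - \<Union>C - InV C)) \<subseteq> \<Union>(C \<inter> C)" by (simp add: Int_Un_distrib Int_Un_distrib2)
  note glue = tiling_glue[OF F1 F2 dE dE _ _ _ v n]
  have glue1: "card (F1 \<union> F2) = card F1 + card F2" by (rule glue(1)) auto
  have glue2: "card {D \<in> F1 \<union> F2. e \<in> D} = 2" if "e \<in> E" for e
    by (rule glue(2)) (use that in auto)
  have glue4: "link_connected (F1 \<union> F2) y" for y by (rule glue(4)) auto
  have fin: "finite V" "finite E" using simple_graph_finite[OF simple] by auto
  have "card F1 + card (InV C) = card (InE C) + 1"
    "card F2 + card (V - \<Union>C - InV C) = card (E - C - InE C) + 1"
    using F1 F2 by (simp_all add: tiling_def)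
  moreover have "card V = card (\<Union>C) + card (InV C) + card (V - \<Union>C - InV C)"
  proof -
    have "V = (\<Union>C \<union> InV C) \<union> (V - \<Union>C - InV C)"
      using subV CE simple_graph_finite(3)[OF simple] by blast
    moreover have "(\<Union>C \<union> InV C) \<inter> (V - \<Union>C - InV C) = {}" by blast
    ultimately have "card V = card (\<Union>C \<union> InV C) + card (V - \<Union>C - InV C)"
      using fin by (metis card_Un_disjoint finite_Un)
    also have "card (\<Union>C \<union> InV C) = card (\<Union>C) + card (InV C)"
      using dV is_cyc_card(2)[OF C] finite_subset[OF subV fin(1)] by (intro card_Un_disjoint) auto
    finally show ?thesis .
  qed
  moreover have "card E = card C + card (InE C) + card (E - C - InE C)"
  proof -
    have "E = (C \<union> InE C) \<union> (E - C - InE C)" using subE CE by blast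
    moreover have "(C \<union> InE C) \<inter> (E - C - InE C) = {}" by blast
    ultimately have "card E = card (C \<union> InE C) + card (E - C - InE C)"
      using fin by (metis card_Un_disjoint finite_Un)
    also have "card (C \<union> InE C) = card C + card (InE C)"
      using dE is_cyc_card(1)[OF C] finite_subset[OF subE fin(2)] by (intro card_Un_disjoint) auto
    finally show ?thesis .
  qed
  ultimately have "card (F1 \<union> F2) + card V = card E + 2"
    using glue1 is_cyc_card(3)[OF C] by simp
  moreover have "finite (F1 \<union> F2)" "\<forall>D\<in>F1 \<union> F2. is_cyc E D"
    using F1 F2 by (auto simp: tiling_def)
  ultimately show ?thesis using glue2 glue4 by metis
qed

section \<open>Discharging and edge assignments\<close>

text \<open>Each of the two faces has only \<open>e1\<close> and \<open>e2\<close> at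
  \<open>y\<close>, and these edges lie in no third face. So the pair is closed under adjacency at
  \<open>y\<close>, and by \<open>link\<close> no other face meets \<open>y\<close>; hence there is
  no further edge at \<open>y\<close>.\<close>

lemma shared_edges_degree_two:
  assumes "finite F" and cyc: "\<And>D. D \<in> F \<Longrightarrow> is_cyc E D"
    and two: "\<And>e. e \<in> E \<Longrightarrow> card {D \<in> F. e \<in> D} = 2" and link: "link_connected F y"
    and D: "D1 \<in> F" "D2 \<in> F" "D1 \<noteq> D2"
    and e: "e1 \<noteq> e2" "y \<in> e1" "y \<in> e2" "e1 \<in> D1" "e2 \<in> D1" "e1 \<in> D2" "e2 \<in> D2"
  shows "card {e \<in> E. y \<in> e} \<le> 2"
proof -
  have at_y: "{d \<in> D. y \<in> d} = {e1, e2}" if DF: "D \<in> F" "e1 \<in> D" "e2 \<in> D" for D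
  proof -
    have yD: "y \<in> \<Union>D" using DF e by auto
    obtain d1 d2 where d: "{d \<in> D. y \<in> d} = {d1, d2}" using is_cyc_incident[OF cyc[OF DF(1)] yD] by metis
    have "e1 \<in> {d \<in> D. y \<in> d}" "e2 \<in> {d \<in> D. y \<in> d}" using DF e by auto
    then have "e1 \<in> {d1, d2}" "e2 \<in> {d1, d2}" using d by metis+
    then have "{d1, d2} = {e1, e2}" using e(1) by auto
    then show ?thesis using d by metis
  qed
  have faces: "{D \<in> F. d \<in> D} = {D1, D2}" if "d \<in> D1" "d \<in> D2" for d
  proof -
    have "d \<in> E" using is_cyc_card(6)[OF cyc[OF D(1)]] that by auto
    then have "card {D \<in> F. d \<in> D} = card {D1, D2}" using two D(3) by simp
    moreover have "{D1, D2} \<subseteq> {D \<in> F. d \<in> D}" using D that by auto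
    moreover have "finite {D \<in> F. d \<in> D}" using assms(1) by simp
    ultimately show ?thesis using card_subset_eq by metis
  qed
  have sub: "d = e1 \<or> d = e2" if "D \<in> {D1, D2}" "d \<in> D" "y \<in> d" for D d
  proof -
    have "{d \<in> D. y \<in> d} = {e1, e2}" using at_y[of D] D e that(1) by auto
    then show ?thesis using that(2,3) by auto
  qed
  have closed: "D' \<in> {D1, D2}" if "D \<in> {D1, D2}" "D' \<in> F" "y \<in> d" "d \<in> D" "d \<in> D'" for D D' d
  proof -
    have "d = e1 \<or> d = e2" using sub that by metis
    then have "{D \<in> F. d \<in> D} = {D1, D2}" using faces e by auto
    then show ?thesis using that by auto
  qed
  have "(\<forall>D\<in>F. y \<in> \<Union>D \<longrightarrow> D \<in> {D1, D2}) \<or> (\<forall>D\<in>F. y \<in> \<Union>D \<longrightarrow> D \<notin> {D1, D2})"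
  proof (rule link[unfolded link_connected_def, rule_format])
    show "{D1, D2} \<subseteq> F" using D by simp
  qed (use closed in metis)
  moreover have "y \<in> \<Union>D1" using e by auto
  ultimately have all: "D \<in> {D1, D2}" if "D \<in> F" "y \<in> \<Union>D" for D using that D(1) by (metis insertI1)
  have "{e \<in> E. y \<in> e} \<subseteq> {e1, e2}"
  proof
    fix d assume d: "d \<in> {e \<in> E. y \<in> e}"
    then have "card {D \<in> F. d \<in> D} \<noteq> 0" using two[of d] by simp
    then have "{D \<in> F. d \<in> D} \<noteq> {}" by (metis card.empty)
    then obtain D where D': "D \<in> F" "d \<in> D" by auto
    then have "D \<in> {D1, D2}" using all d by auto
    then show "d \<in> {e1, e2}" using sub D' d by auto
  qed
  then have "card {e \<in> E. y \<in> e} \<le> card {e1, e2}" by (intro card_mono) auto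
  then show ?thesis using e(1) by simp
qed

section \<open>The graph class and its heredity\<close>

text \<open>The hypotheses of the theorem as one predicate, which passes to subgraphs and so can
  carry an induction.\<close>

definition few_triangles :: "'a set \<Rightarrow> 'a set set \<Rightarrow> bool" where
  "few_triangles V E \<longleftrightarrow> simple_graph V E \<and> planar_graph V E \<and>
     (\<forall>T1 T2. triangle V E T1 \<and> triangle V E T2 \<and> T1 \<noteq> T2 \<longrightarrow> \<not> intersecting_cycles T1 T2) \<and>
     (\<forall>T. triangle V E T \<longrightarrow> card {Q. is_cycle V E 4 Q \<and> adjacent_cycles T Q} \<le> 1)"

lemma is_cycle_mono: "is_cycle V' E' k C \<Longrightarrow> V' \<subseteq> V \<Longrightarrow> E' \<subseteq> E \<Longrightarrow> is_cycle V E k C"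
  unfolding is_cycle_def by (metis subset_trans)

lemma finite_cycles: "simple_graph V E \<Longrightarrow> finite {Q. is_cycle V E k Q \<and> P Q}"
proof -
  assume "simple_graph V E"
  then have "finite (Pow E)" using simple_graph_finite(2) by blast
  then show ?thesis by (rule finite_subset[rotated]) (auto simp: is_cycle_def)
qed

lemma planar_graph_mono:
  fixes V V' :: "'a set"
  assumes "planar_graph V E" "V' \<subseteq> V" "E' \<subseteq> E" "\<And>e. e \<in> E' \<Longrightarrow> e \<subseteq> V'"
  shows "planar_graph V' E'"
proof -
  obtain p :: "'a \<Rightarrow> complex" and \<gamma> where inj: "inj_on p V" and
    1: "\<forall>e\<in>E. arc (\<gamma> e) \<and> {pathstart (\<gamma> e), pathfinish (\<gamma> e)} = p ` e \<and>
                path_image (\<gamma> e) \<inter> p ` V = p ` e" and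
    2: "\<forall>e1\<in>E. \<forall>e2\<in>E. e1 \<noteq> e2 \<longrightarrow>
                path_image (\<gamma> e1) \<inter> path_image (\<gamma> e2) \<subseteq> p ` (e1 \<inter> e2)"
    using assms(1) unfolding planar_graph_def by (elim exE conjE)
  have "path_image (\<gamma> e) \<inter> p ` V' = p ` e" if "e \<in> E'" for e
  proof -
    have gen: "S \<inter> A = C" if "S \<inter> B = C" "A \<subseteq> B" "C \<subseteq> A" for S A B C :: "complex set"
      using that by blast
    have "path_image (\<gamma> e) \<inter> p ` V = p ` e" using 1 that assms(3) by (meson subsetD)
    moreover have "p ` V' \<subseteq> p ` V" "p ` e \<subseteq> p ` V'" using assms(2) assms(4)[OF that] by (simp_all add: image_mono)
    ultimately show ?thesis by (rule gen)
  qed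
  moreover have "inj_on p V'" using inj assms(2) by (rule inj_on_subset)
  ultimately show ?thesis unfolding planar_graph_def using 1 2 assms(3)
    by (intro exI[of _ p] exI[of _ \<gamma>]) (simp add: subset_iff)
qed

lemma few_triangles_mono:
  assumes g: "few_triangles V E" and s: "V' \<subseteq> V" "E' \<subseteq> E" "\<And>e. e \<in> E' \<Longrightarrow> e \<subseteq> V'"
  shows "few_triangles V' E'"
proof -
  have simple: "simple_graph V E" using g by (simp add: few_triangles_def)
  have "simple_graph V' E'"
    unfolding simple_graph_def
  proof (intro conjI ballI)
    show "finite V'" using simple_graph_finite(1)[OF simple] s(1) finite_subset by metis
    fix e assume e: "e \<in> E'"
    obtain u v where "e = {u, v}" "u \<noteq> v" using simple_graph_edgeE[OF simple] e s(2) by (metis subsetD)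
    then show "\<exists>u v. e = {u, v} \<and> u \<noteq> v \<and> u \<in> V' \<and> v \<in> V'" using s(3)[OF e] by auto
  qed
  moreover have "planar_graph V' E'" using g s planar_graph_mono unfolding few_triangles_def by metis
  moreover have "\<not> intersecting_cycles T1 T2"
    if "triangle V' E' T1 \<and> triangle V' E' T2 \<and> T1 \<noteq> T2" for T1 T2
    using that g is_cycle_mono[OF _ s(1,2)] unfolding few_triangles_def by metis
  moreover have "card {Q. is_cycle V' E' 4 Q \<and> adjacent_cycles T Q} \<le> 1" if "triangle V' E' T" for T
  proof -
    have "{Q. is_cycle V' E' 4 Q \<and> adjacent_cycles T Q} \<subseteq> {Q. is_cycle V E 4 Q \<and> adjacent_cycles T Q}"
      using is_cycle_mono[OF _ s(1,2)] by auto
    then have "card {Q. is_cycle V' E' 4 Q \<and> adjacent_cycles T Q} \<le> card {Q. is_cycle V E 4 Q \<and> adjacent_cycles T Q}"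
      by (rule card_mono[OF finite_cycles[OF simple]])
    also have "\<dots> \<le> 1" using g is_cycle_mono[OF that s(1,2)] unfolding few_triangles_def by metis
    finally show ?thesis .
  qed
  ultimately show ?thesis unfolding few_triangles_def by simp
qed

lemma edge_card: "simple_graph V E \<Longrightarrow> e \<in> E \<Longrightarrow> finite e \<and> card e = 2"
  using simple_graph_edgeE[of V E e] by (metis card_2_iff finite.emptyI finite_insert)

section \<open>Discharging\<close>

lemma discharging:
  assumes g: "few_triangles V E" and bi: "biconnected V E" and "V \<noteq> {}"
    and deg: "\<forall>v\<in>V. 3 \<le> card {e \<in> E. v \<in> e}"
  shows "card E + 4 \<le> 2 * card V"
proof -
  have simple: "simple_graph V E" and planar: "planar_graph V E" using g by (simp_all add: few_triangles_def)
  note fin = simple_graph_finite[OF simple]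
  obtain F where finF: "finite F" and cyc: "\<And>D. D \<in> F \<Longrightarrow> is_cyc E D"
    and two: "\<And>e. e \<in> E \<Longrightarrow> card {D \<in> F. e \<in> D} = 2"
    and euler: "card F + card V = card E + 2" and link: "\<And>y. link_connected F y"
    using planar_faces_exist[OF planar simple bi assms(3) deg] by (elim exE conjE) simp
  have cycle: "is_cycle V E (card D) D" if "D \<in> F" for D using is_cyc_is_cycle[OF cyc[OF that] fin(3)] .
  have ge3: "3 \<le> card D" "finite D" "D \<subseteq> E" if "D \<in> F" for D
    using is_cyc_card(4)[OF cyc[OF that]] is_cyc_card(1)[OF cyc[OF that]] is_cyc_card(6)[OF cyc[OF that]] .
  \<comment> \<open>Two faces sharing two edges at a vertex would force degree at most 2 there,
    against \<open>deg\<close>.\<close>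
  have no_shared: "e1 \<inter> e2 = {}"
    if "D1 \<in> F" "D2 \<in> F" "D1 \<noteq> D2" "e1 \<noteq> e2" "e1 \<in> D1" "e2 \<in> D1" "e1 \<in> D2" "e2 \<in> D2" for D1 D2 e1 e2
  proof (rule ccontr)
    assume "e1 \<inter> e2 \<noteq> {}"
    then obtain y where y: "y \<in> e1" "y \<in> e2" by auto
    have "card {e \<in> E. y \<in> e} \<le> 2"
      using shared_edges_degree_two[OF finF cyc two link that(1-3,4) y that(5-8)] .
    moreover have "y \<in> V" using y that ge3(3)[OF that(1)] fin(3) by auto
    then have "3 \<le> card {e \<in> E. y \<in> e}" using deg by simp
    ultimately show False by linarith
  qed
  define T where "T = {D \<in> F. card D = 3}"
  define B where "B = {D \<in> F. 5 \<le> card D}"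
  \<comment> \<open>The edges across which charge moves. They are counted from both sides, with
    charges doubled to remain in the natural numbers: at least \<open>2 * card T\<close> of them
    seen from the triangles, at most the sum of \<open>2 * (card D - 4)\<close> seen from the large
    faces.\<close>
  define X where "X = {e \<in> E. (\<exists>D\<in>T. e \<in> D) \<and> (\<exists>D\<in>B. e \<in> D)}"
  have finTB: "finite T" "finite B" "finite X" using finF fin(2) by (simp_all add: T_def B_def X_def)
  have TF: "D \<in> F" "triangle V E D" if "D \<in> T" for D using that cycle[of D] by (auto simp: T_def)
  have disjT: "\<Union>D1 \<inter> \<Union>D2 = {}" if "D1 \<in> T" "D2 \<in> T" "D1 \<noteq> D2" for D1 D2
  proof -
    have "\<not> intersecting_cycles D1 D2" using g TF(2) that unfolding few_triangles_def by metis
    then show ?thesis by (simp add: intersecting_cycles_def cycle_vertices_def)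
  qed
  have lower: "2 \<le> card (X \<inter> D)" if D: "D \<in> T" for D
  proof -
    have D3: "card D = 3" "D \<in> F" using D by (auto simp: T_def)
    \<comment> \<open>The face across such an edge is not large, as \<open>e\<close> is not in
      \<open>X\<close>, and no triangle, as triangles are disjoint, so it is a 4-cycle.\<close>
    have other: "\<exists>D'\<in>F. D' \<noteq> D \<and> e \<in> D' \<and> is_cycle V E 4 D' \<and> adjacent_cycles D D'"
      if e: "e \<in> D - X" for e
    proof -
      have eE: "e \<in> E" using e ge3(3)[OF D3(2)] by auto
      have "\<not> {D' \<in> F. e \<in> D'} \<subseteq> {D}"
      proof
        assume "{D' \<in> F. e \<in> D'} \<subseteq> {D}"
        then have "card {D' \<in> F. e \<in> D'} \<le> card {D}" by (intro card_mono) auto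
        then show False using two[OF eE] by simp
      qed
      then obtain D' where D': "D' \<in> F" "D' \<noteq> D" "e \<in> D'" by auto
      have "D' \<notin> B" using e D' D eE by (auto simp: X_def)
      moreover have "D' \<notin> T"
      proof
        assume "D' \<in> T"
        then have "\<Union>D' \<inter> \<Union>D = {}" using disjT D D'(2) by simp
        moreover have "e \<noteq> {}" using edge_card[OF simple eE] by auto
        then obtain x where "x \<in> e" by auto
        then have "x \<in> \<Union>D' \<inter> \<Union>D" using D'(3) e by auto
        ultimately show False by simp
      qed
      ultimately have "card D' = 4" using ge3(1)[OF D'(1)] D'(1) by (simp add: T_def B_def)
      then have "is_cycle V E 4 D'" using cycle[OF D'(1)] by simp
      moreover have "adjacent_cycles D D'" using e D' by (auto simp: adjacent_cycles_def)
      ultimately show ?thesis using D' by auto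
    qed
    \<comment> \<open>Two such edges would border the same 4-cycle by the hypothesis on 4-cycles,
      hence be disjoint by \<open>no_shared\<close>; but a triangle has only three vertices.\<close>
    have uniq: "e = e'" if e: "e \<in> D - X" "e' \<in> D - X" for e e'
    proof (rule ccontr)
      assume "e \<noteq> e'"
      obtain D1 where D1: "D1 \<in> F" "D1 \<noteq> D" "e \<in> D1" "is_cycle V E 4 D1" "adjacent_cycles D D1"
        using other[OF e(1)] by auto
      obtain D2 where D2: "D2 \<in> F" "D2 \<noteq> D" "e' \<in> D2" "is_cycle V E 4 D2" "adjacent_cycles D D2"
        using other[OF e(2)] by auto
      let ?Q = "{Q. is_cycle V E 4 Q \<and> adjacent_cycles D Q}"
      have "card ?Q \<le> 1" using g TF(2)[OF D] unfolding few_triangles_def by metis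
      moreover have "card {D1, D2} \<le> card ?Q"
        using D1 D2 finite_cycles[OF simple] by (intro card_mono) auto
      ultimately have "D1 = D2" by (cases "D1 = D2") auto
      then have "e \<inter> e' = {}" using no_shared[of D D1 e e'] D1 D2 D3 e \<open>e \<noteq> e'\<close> by auto
      moreover have "e \<in> E" "e' \<in> E" using e ge3(3)[OF D3(2)] by auto
      ultimately have "card (e \<union> e') = 4" using edge_card[OF simple] by (simp add: card_Un_disjoint)
      moreover have "card (e \<union> e') \<le> card (\<Union>D)"
        using e is_cyc_card(2)[OF cyc[OF D3(2)]] by (intro card_mono) auto
      ultimately show False using is_cyc_card(3)[OF cyc[OF D3(2)]] D3 by simp
    qed
    have "card (D - X) \<le> 1"
      using uniq by (metis card_le_Suc0_iff_eq One_nat_def finite_Diff ge3(2)[OF D3(2)])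
    moreover have "card D = card (X \<inter> D) + card (D - X)"
      using ge3(2)[OF D3(2)] by (metis Int_commute card_Int_Diff)
    ultimately show ?thesis using D3 by simp
  qed
  have upper: "card (X \<inter> D) \<le> 2 * (card D - 4)" if D: "D \<in> B" for D
  proof -
    have D5: "5 \<le> card D" "D \<in> F" using D by (auto simp: B_def)
    \<comment> \<open>The edges of \<open>X\<close> on \<open>D\<close> form a matching: two from
      the same triangle are disjoint by \<open>no_shared\<close>, two from different triangles
      because the triangles are.\<close>
    have "disjnt e e'" if e: "e \<in> X \<inter> D" "e' \<in> X \<inter> D" "e \<noteq> e'" for e e'
    proof -
      obtain T1 T2 where T12: "T1 \<in> T" "e \<in> T1" "T2 \<in> T" "e' \<in> T2" using e by (auto simp: X_def)
      show ?thesis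
      proof (cases "T1 = T2")
        case True
        have "T1 \<noteq> D" using T12(1) D5 by (auto simp: T_def)
        then show ?thesis using no_shared[of T1 D e e'] TF(1)[OF T12(1)] D5 T12 e True by (simp add: disjnt_def)
      next
        case False
        then have "\<Union>T1 \<inter> \<Union>T2 = {}" using disjT T12 by simp
        moreover have "e \<subseteq> \<Union>T1" "e' \<subseteq> \<Union>T2" using T12 by auto
        ultimately show ?thesis unfolding disjnt_def by blast
      qed
    qed
    then have "pairwise disjnt (X \<inter> D)" by (simp add: pairwise_def)
    moreover have ec: "finite e \<and> card e = 2" if "e \<in> X \<inter> D" for e
      using edge_card[OF simple] that by (auto simp: X_def)
    ultimately have "card (\<Union>(X \<inter> D)) = (\<Sum>e\<in>X \<inter> D. card e)" by (intro card_Union_disjoint) auto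
    also have "\<dots> = 2 * card (X \<inter> D)" using ec by simp
    finally have "2 * card (X \<inter> D) \<le> card (\<Union>D)"
      using card_mono[OF is_cyc_card(2)[OF cyc[OF D5(2)]], of "\<Union>(X \<inter> D)"] by auto
    then have "2 * card (X \<inter> D) \<le> card D" using is_cyc_card(3)[OF cyc[OF D5(2)]] by simp
    \<comment> \<open>With \<open>m = card (X \<inter> D)\<close> and \<open>d = card D\<close>,
      this passes from \<open>2 * m \<le> d\<close> to \<open>m \<le> 2 * (d - 4)\<close>; for
      \<open>d = 5\<close> it depends on \<open>m\<close> being an integer.\<close>
    then show ?thesis using D5(1) by presburger
  qed
  have "2 * card T \<le> (\<Sum>D\<in>T. card (X \<inter> D))"
    using sum_mono[of T "\<lambda>_. 2" "\<lambda>D. card (X \<inter> D)"] lower by simp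
  also have "\<dots> = card (\<Union>D\<in>T. X \<inter> D)"
  proof (rule card_UN_disjoint[symmetric])
    show "\<forall>D1\<in>T. \<forall>D2\<in>T. D1 \<noteq> D2 \<longrightarrow> (X \<inter> D1) \<inter> (X \<inter> D2) = {}"
    proof (intro ballI impI, rule ccontr)
      fix D1 D2 assume D: "D1 \<in> T" "D2 \<in> T" "D1 \<noteq> D2" "(X \<inter> D1) \<inter> (X \<inter> D2) \<noteq> {}"
      then obtain e where e: "e \<in> X" "e \<in> D1" "e \<in> D2" by auto
      then have "e \<noteq> {}" using edge_card[OF simple, of e] by (auto simp: X_def)
      then obtain x where "x \<in> e" by auto
      then have "x \<in> \<Union>D1 \<inter> \<Union>D2" using e by auto
      then show False using disjT[OF D(1-3)] by simp
    qed
  qed (use finTB in auto)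
  also have "\<dots> \<le> card (\<Union>D\<in>B. X \<inter> D)"
    using finTB by (intro card_mono) (auto simp: X_def)
  also have "\<dots> \<le> (\<Sum>D\<in>B. card (X \<inter> D))" by (rule card_UN_le[OF finTB(2)])
  also have "\<dots> \<le> (\<Sum>D\<in>B. 2 * (card D - 4))" using upper by (rule sum_mono)
  finally have T_le: "card T \<le> (\<Sum>D\<in>B. card D - 4)" by (simp add: sum_distrib_left[symmetric])
  define Q where "Q = {D \<in> F. card D = 4}"
  have F_split: "F = (T \<union> Q) \<union> B" "T \<inter> Q = {}" "(T \<union> Q) \<inter> B = {}" "finite Q"
  proof -
    have "card D = 3 \<or> card D = 4 \<or> 5 \<le> card D" if "D \<in> F" for D using ge3(1)[OF that] by linarith
    then show "F = (T \<union> Q) \<union> B" by (auto simp: T_def Q_def B_def)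
  qed (auto simp: T_def Q_def B_def finF)
  have sums: "(\<Sum>D\<in>F. f D) = (\<Sum>D\<in>T. f D) + (\<Sum>D\<in>Q. f D) + (\<Sum>D\<in>B. f D)" for f :: "'a set set \<Rightarrow> nat"
    unfolding F_split(1) using finTB F_split by (simp add: sum.union_disjoint)
  have "4 * card F = 4 * card T + 4 * card Q + 4 * card B"
    using sums[of "\<lambda>_. 4"] by simp
  also have "\<dots> \<le> 3 * card T + 4 * card Q + ((\<Sum>D\<in>B. card D - 4) + 4 * card B)" using T_le by simp
  also have "(\<Sum>D\<in>B. card D - 4) + 4 * card B = (\<Sum>D\<in>B. (card D - 4) + 4)"
    by (simp add: sum.distrib)
  \<comment> \<open>The truncated subtraction is exact because every member of \<open>B\<close> has
    at least five edges.\<close>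
  also have "\<dots> = (\<Sum>D\<in>B. card D)" by (rule sum.cong) (auto simp: B_def)
  also have "3 * card T + 4 * card Q + (\<Sum>D\<in>B. card D) = (\<Sum>D\<in>F. card D)"
    using sums[of card] by (simp add: T_def Q_def)
  \<comment> \<open>Double counting of incidences between edges and faces, each edge being on two
    faces.\<close>
  also have "\<dots> = (\<Sum>D\<in>F. \<Sum>e\<in>E. if e \<in> D then 1 else 0)"
  proof (rule sum.cong)
    fix D assume "D \<in> F"
    then have "E \<inter> D = D" using ge3(3) by auto
    then show "card D = (\<Sum>e\<in>E. if e \<in> D then 1 else 0)"
      using fin(2) by (simp add: sum.If_cases Int_def[symmetric] Collect_mem_eq)
  qed simp
  also have "\<dots> = (\<Sum>e\<in>E. \<Sum>D\<in>F. if e \<in> D then 1 else 0)" by (rule sum.swap)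
  also have "\<dots> = (\<Sum>e\<in>E. card {D \<in> F. e \<in> D})"
    using finF by (intro sum.cong) (simp_all add: sum.If_cases Int_def)
  also have "\<dots> = 2 * card E" using two by simp
  finally show ?thesis using euler by linarith
qed

section \<open>The edge bound by induction on the number of vertices\<close>

text \<open>The constant 2 suits the induction: a single vertex attains it, deleting a vertex of
  degree at most 2 preserves it, and the bounds for two parts overlapping in at most one vertex add
  up to \<open>card E + 4 \<le> 2 * (card V + 1)\<close>. In the remaining case
  \<open>discharging\<close> gives even the constant 4.\<close>

theorem few_triangles_edge_bound:
  assumes "few_triangles V E" "V \<noteq> {}"
  shows "card E + 2 \<le> 2 * card V"
  using assms
proof (induction "card V" arbitrary: V E rule: less_induct)
  case less
  note g = less.prems(1)
  have simple: "simple_graph V E" using g by (simp add: few_triangles_def)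
  note fin = simple_graph_finite[OF simple]
  have eV: "e \<subseteq> V" if "e \<in> E" for e using fin(3) that by auto
  have IH: "card {e \<in> E. e \<subseteq> W} + 2 \<le> 2 * card W" if "W \<subset> V" "W \<noteq> {}" for W
  proof (rule less.hyps)
    show "card W < card V" using that fin(1) by (simp add: psubset_card_mono)
    show "few_triangles W {e \<in> E. e \<subseteq> W}" using that by (intro few_triangles_mono[OF g]) auto
  qed (use that in simp)
  show ?case
  proof (cases "\<forall>v\<in>V. 3 \<le> card {e \<in> E. v \<in> e}")
    case False
    then obtain v where v: "v \<in> V" "card {e \<in> E. v \<in> e} \<le> 2" by force
    have split: "E = {e \<in> E. v \<in> e} \<union> {e \<in> E. e \<subseteq> V - {v}}" using eV by blast
    show ?thesis
    proof (cases "V = {v}")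
      case True
      have "E = {}"
      proof (rule ccontr)
        assume "E \<noteq> {}"
        then obtain e where "e \<in> E" by auto
        then show False using simple_graph_edgeE[OF simple] True by (metis singletonD)
      qed
      then show ?thesis using True by simp
    next
      case False
      have cV: "card V = card (V - {v}) + 1" using card.remove[OF fin(1) v(1)] by simp
      have "card E \<le> card {e \<in> E. v \<in> e} + card {e \<in> E. e \<subseteq> V - {v}}"
        using card_Un_le[of "{e \<in> E. v \<in> e}" "{e \<in> E. e \<subseteq> V - {v}}"] split by simp
      moreover have "card {e \<in> E. e \<subseteq> V - {v}} + 2 \<le> 2 * card (V - {v})"
        using v False by (intro IH) auto
      ultimately show ?thesis using v cV by linarith
    qed
  next
    case deg: True
    show ?thesis
    proof (cases "biconnected V E")
      case True
      then show ?thesis using discharging[OF g _ less.prems(2) deg] by simp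
    next
      case False
      then obtain V1 V2 where V12: "V1 \<union> V2 = V" "V1 \<noteq> V" "V2 \<noteq> V" "card (V1 \<inter> V2) \<le> 1"
        and e: "\<forall>e\<in>E. e \<subseteq> V1 \<or> e \<subseteq> V2" unfolding biconnected_def by metis
      have "V1 \<subset> V" "V2 \<subset> V" "V1 \<noteq> {}" "V2 \<noteq> {}" using V12(1-3) by auto
      then have "card {e \<in> E. e \<subseteq> V1} + 2 \<le> 2 * card V1" "card {e \<in> E. e \<subseteq> V2} + 2 \<le> 2 * card V2"
        using IH by auto
      moreover have "card E \<le> card {e \<in> E. e \<subseteq> V1} + card {e \<in> E. e \<subseteq> V2}"
      proof -
        have "E = {e \<in> E. e \<subseteq> V1} \<union> {e \<in> E. e \<subseteq> V2}" using e by blast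
        then show ?thesis by (metis card_Un_le)
      qed
      moreover have "card V1 + card V2 = card V + card (V1 \<inter> V2)"
        using card_Un_Int[of V1 V2] V12(1) fin(1) by (metis finite_Un)
      ultimately show ?thesis using V12(4) by linarith
    qed
  qed
qed

text \<open>Hakimi's criterion. If neither endpoint \<open>x\<close>, \<open>y\<close> of the next edge could receive it, there would
  be tight sets \<open>X\<close> and \<open>Y\<close> containing exactly \<open>x\<close> and \<open>y\<close>, and by submodularity \<open>X \<union> Y\<close> would
  span too many edges.\<close>

lemma edge_assignment:
  fixes k :: "'a \<Rightarrow> nat"
  assumes "finite E" "finite V"
    and "\<And>e. e \<in> E \<Longrightarrow> \<exists>x y. e = {x, y} \<and> x \<noteq> y \<and> x \<in> V \<and> y \<in> V"
    and "\<And>X. X \<subseteq> V \<Longrightarrow> card {e \<in> E. e \<subseteq> X} \<le> sum k X"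
  shows "\<exists>h. (\<forall>e\<in>E. h e \<in> e) \<and> (\<forall>v\<in>V. card {e \<in> E. h e = v} \<le> k v)"
  using assms(1,3,4)
proof (induction E arbitrary: k)
  case empty
  then show ?case by simp
next
  case (insert e0 E)
  note finV = assms(2)
  define S where "S X = {e \<in> E. e \<subseteq> X}" for X
  have finS: "finite (S X)" for X using insert.hyps by (simp add: S_def)
  have span: "card {e \<in> insert e0 E. e \<subseteq> X} = (if e0 \<subseteq> X then card (S X) + 1 else card (S X))" for X
  proof -
    have "{e \<in> insert e0 E. e \<subseteq> X} = (if e0 \<subseteq> X then insert e0 (S X) else S X)" by (auto simp: S_def)
    moreover have "e0 \<notin> S X" using insert.hyps by (simp add: S_def)
    ultimately show ?thesis using finS by simp
  qed
  have cond: "(if e0 \<subseteq> X then card (S X) + 1 else card (S X)) \<le> sum k X" if "X \<subseteq> V" for X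
    using insert.prems(2)[OF that] span[of X] by simp
  obtain x y where xy: "e0 = {x, y}" "x \<noteq> y" "x \<in> V" "y \<in> V" using insert.prems(1)[of e0] by auto
  define ok where "ok a \<longleftrightarrow> (\<forall>X\<subseteq>V. a \<in> X \<and> \<not> e0 \<subseteq> X \<longrightarrow> card (S X) + 1 \<le> sum k X)" for a
  have "\<exists>h. (\<forall>e\<in>insert e0 E. h e \<in> e) \<and> (\<forall>v\<in>V. card {e \<in> insert e0 E. h e = v} \<le> k v)"
    if a: "a \<in> e0" "ok a" for a
  proof -
    have aV: "a \<in> V" using a xy by auto
    have "\<not> e0 \<subseteq> {a}" using xy by auto
    \<comment> \<open>The singleton shows that \<open>a\<close> has capacity left, so that the
      subtraction in \<open>k'\<close> is exact.\<close>
    then have "card (S {a}) + 1 \<le> sum k {a}"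
      using a(2)[unfolded ok_def, rule_format, of "{a}"] aV by simp
    then have ka: "1 \<le> k a" by simp
    define k' where "k' = k(a := k a - 1)"
    have "card {e \<in> E. e \<subseteq> X} \<le> sum k' X" if X: "X \<subseteq> V" for X
    proof (cases "a \<in> X")
      case True
      have finX: "finite X" using X finV finite_subset by metis
      have "sum k X = k a + sum k (X - {a})" "sum k' X = k' a + sum k' (X - {a})"
        using True finX by (simp_all add: sum.remove)
      moreover have "sum k' (X - {a}) = sum k (X - {a})" by (rule sum.cong) (auto simp: k'_def)
      ultimately have "sum k X = sum k' X + 1" using ka by (simp add: k'_def)
      moreover have "card (S X) + 1 \<le> sum k X"
        using a(2) cond[OF X] True X unfolding ok_def by (cases "e0 \<subseteq> X") auto
      ultimately show ?thesis by (simp add: S_def)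
    next
      case False
      then have "sum k' X = sum k X" by (intro sum.cong) (auto simp: k'_def)
      then show ?thesis using cond[OF X] by (auto simp: S_def split: if_splits)
    qed
    then obtain h where h: "\<forall>e\<in>E. h e \<in> e" "\<forall>v\<in>V. card {e \<in> E. h e = v} \<le> k' v"
      using insert.IH[of k'] insert.prems(1) by auto
    define h' where "h' = h(e0 := a)"
    have "card {e \<in> insert e0 E. h' e = v} \<le> k v" if v: "v \<in> V" for v
    proof -
      have "{e \<in> insert e0 E. h' e = v} = (if v = a then insert e0 {e \<in> E. h e = v} else {e \<in> E. h e = v})"
        using insert.hyps by (auto simp: h'_def)
      moreover have "card (insert e0 {e \<in> E. h e = a}) = card {e \<in> E. h e = a} + 1"
        using insert.hyps by simp
      moreover have "card {e \<in> E. h e = v} \<le> k' v" using h v by simp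
      ultimately show ?thesis using ka by (auto simp: k'_def)
    qed
    moreover have "\<forall>e\<in>insert e0 E. h' e \<in> e" using h(1) a(1) by (auto simp: h'_def)
    ultimately show ?thesis by auto
  qed
  moreover have "ok x \<or> ok y"
  proof (rule ccontr)
    assume "\<not> (ok x \<or> ok y)"
    then obtain X Y where X: "X \<subseteq> V" "x \<in> X" "\<not> e0 \<subseteq> X" "sum k X \<le> card (S X)"
      and Y: "Y \<subseteq> V" "y \<in> Y" "\<not> e0 \<subseteq> Y" "sum k Y \<le> card (S Y)"
      unfolding ok_def by (metis Suc_eq_plus1 not_less_eq_eq)
    have finXY: "finite X" "finite Y" using X Y finV finite_subset by metis+
    have "card (S X) + card (S Y) = card (S X \<union> S Y) + card (S X \<inter> S Y)"
      by (rule card_Un_Int[OF finS finS])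
    also have "card (S X \<union> S Y) \<le> card (S (X \<union> Y))" by (rule card_mono[OF finS]) (auto simp: S_def)
    also have "S X \<inter> S Y = S (X \<inter> Y)" by (auto simp: S_def)
    finally have "sum k X + sum k Y \<le> card (S (X \<union> Y)) + card (S (X \<inter> Y))" using X Y by linarith
    moreover have "card (S (X \<union> Y)) + 1 \<le> sum k (X \<union> Y)"
      using cond[of "X \<union> Y"] X Y xy(1) by simp
    moreover have "card (S (X \<inter> Y)) \<le> sum k (X \<inter> Y)"
      using cond[of "X \<inter> Y"] X by (auto split: if_splits)
    moreover have "sum k (X \<union> Y) + sum k (X \<inter> Y) = sum k X + sum k Y"
      by (rule sum.union_inter[OF finXY])
    ultimately show False by linarith
  qed
  ultimately show ?case using xy(1) by blast
qed

section \<open>From edge assignments to colourings\<close>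

lemma adaptably_choosable_of_assignment:
  assumes simple: "simple_graph V E" and h: "\<forall>e\<in>E. h e \<in> e" "\<forall>v\<in>V. card {e \<in> E. h e = v} \<le> k"
  shows "adaptably_choosable V E (Suc k)"
  unfolding adaptably_choosable_def
proof (intro allI impI)
  fix F :: "'a set \<Rightarrow> int" and L :: "'a \<Rightarrow> int set"
  assume L: "\<forall>v\<in>V. finite (L v) \<and> Suc k \<le> card (L v)"
  have "\<exists>x. x \<in> L v \<and> x \<notin> F ` {e \<in> E. h e = v}" if v: "v \<in> V" for v
  proof (rule ccontr)
    assume "\<not> ?thesis"
    then have "L v \<subseteq> F ` {e \<in> E. h e = v}" by auto
    moreover have fin: "finite {e \<in> E. h e = v}" using simple_graph_finite(2)[OF simple] by simp
    ultimately have "card (L v) \<le> card (F ` {e \<in> E. h e = v})" by (intro card_mono) auto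
    also have "\<dots> \<le> card {e \<in> E. h e = v}" by (rule card_image_le[OF fin])
    also have "\<dots> \<le> k" using h v by simp
    finally show False using L v by fastforce
  qed
  then obtain c where c: "\<And>v. v \<in> V \<Longrightarrow> c v \<in> L v \<and> c v \<notin> F ` {e \<in> E. h e = v}" by metis
  have "adapted E F c"
    unfolding adapted_def
  proof (intro allI impI notI)
    fix u v assume e: "{u, v} \<in> E" and eq: "c u = F {u, v} \<and> c v = F {u, v}"
    have V: "u \<in> V" "v \<in> V" using simple_graph_finite(3)[OF simple] e by auto
    have "h {u, v} = u \<or> h {u, v} = v" using h(1) e by auto
    then show False using c[OF V(1)] c[OF V(2)] e eq by auto
  qed
  then show "\<exists>c. adapted E F c \<and> (\<forall>v\<in>V. c v \<in> L v)" using c by auto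
qed

text \<open>Each edge is coloured with the one colour that the lists of its ends may share. Equal
  colours at the two ends would have to be this colour, which adaptedness forbids.\<close>

lemma kd_choosable_of_adaptably_choosable:
  assumes simple: "simple_graph V E" and ad: "adaptably_choosable V E k"
  shows "kd_choosable V E k 1"
  unfolding kd_choosable_def
proof (intro allI impI)
  fix L assume L: "kd_list_assignment V E k 1 L"
  \<comment> \<open>For disjoint lists \<open>F e\<close> is an arbitrary value; this is harmless,
    as the ends of such an edge cannot receive equal colours.\<close>
  define F where "F e = (SOME x. \<forall>v\<in>e. x \<in> L v)" for e
  have fin: "\<forall>v\<in>V. finite (L v) \<and> k \<le> card (L v)" using L by (simp add: kd_list_assignment_def)
  then obtain c where c: "adapted E F c" "\<forall>v\<in>V. c v \<in> L v" using ad unfolding adaptably_choosable_def by metis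
  have "proper_colouring E c"
    unfolding proper_colouring_def
  proof (intro allI impI notI)
    fix u v assume e: "{u, v} \<in> E" and eq: "c u = c v"
    have V: "u \<in> V" "v \<in> V" using simple_graph_finite(3)[OF simple] e by auto
    have cin: "c u \<in> L u \<inter> L v" using c(2) V eq by auto
    then have "\<forall>w\<in>{u, v}. F {u, v} \<in> L w"
      unfolding F_def by (intro someI[of "\<lambda>x. \<forall>w\<in>{u, v}. x \<in> L w" "c u"]) auto
    then have Fin: "F {u, v} \<in> L u \<inter> L v" by auto
    have "card (L u \<inter> L v) \<le> 1" using L e by (simp add: kd_list_assignment_def)
    then have "c u = F {u, v}" using cin Fin fin V by (metis One_nat_def card_le_Suc0_iff_eq finite_Int)
    then show False using c(1) e eq unfolding adapted_def by metis
  qed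
  then show "\<exists>c. proper_colouring E c \<and> (\<forall>v\<in>V. c v \<in> L v)" using c by auto
qed

theorem theorem3:
  fixes V :: "'a set" and E :: "'a set set"
  assumes "simple_graph V E"
    and "planar_graph V E"
    and "\<forall>T1 T2. triangle V E T1 \<and> triangle V E T2 \<and> T1 \<noteq> T2 \<longrightarrow>
                   \<not> intersecting_cycles T1 T2"
    and "\<forall>T. triangle V E T \<longrightarrow>
              card {Q. is_cycle V E 4 Q \<and> adjacent_cycles T Q} \<le> 1"
  shows "adaptably_choosable V E 3 \<and> kd_choosable V E 3 1"
proof -
  have g: "few_triangles V E" unfolding few_triangles_def using assms by simp
  note fin = simple_graph_finite[OF assms(1)]
  have "\<exists>h. (\<forall>e\<in>E. h e \<in> e) \<and> (\<forall>v\<in>V. card {e \<in> E. h e = v} \<le> 2)"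
  proof (rule edge_assignment[OF fin(2,1)])
    fix e assume "e \<in> E"
    then show "\<exists>x y. e = {x, y} \<and> x \<noteq> y \<and> x \<in> V \<and> y \<in> V"
      using simple_graph_edgeE[OF assms(1)] by metis
  next
    fix X assume X: "X \<subseteq> V"
    show "card {e \<in> E. e \<subseteq> X} \<le> (\<Sum>v\<in>X. 2)"
    \<comment> \<open>The empty set is separate because the edge bound fails there: its constant 2
      exceeds the right-hand side.\<close>
    proof (cases "X = {}")
      case True
      have "{} \<notin> E" using edge_card[OF assms(1), of "{}"] by auto
      then have "{e \<in> E. e \<subseteq> X} = {}" using True by auto
      then show ?thesis by (metis card.empty le0)
    next
      case False
      have "few_triangles X {e \<in> E. e \<subseteq> X}" using X by (intro few_triangles_mono[OF g]) auto
      then show ?thesis using few_triangles_edge_bound[OF _ False] by force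
    qed
  qed
  then have ad: "adaptably_choosable V E 3"
    using adaptably_choosable_of_assignment[OF assms(1), of _ 2] by (auto simp: numeral_3_eq_3 numeral_2_eq_2)
  then show ?thesis using kd_choosable_of_adaptably_choosable[OF assms(1)] by simp
qed

end
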